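(* Let $\beta>0$ be real and let $\phi$ be a probability distribution on $\mathbb{R}$. Define $$\Delta_{\rm KS}(\beta,\phi)=\left(\mathbb{E}\left[\left(\frac{1-\exp(\beta J)}{1+\exp(\beta J)}\right)^2\right]\right)^{-1},$$ where $J\sim\phi$. Then for every integer $\Delta>\Delta_{\rm KS}(\beta,\phi)$ the Gibbs distribution $\mu_{\beta,\phi}$ on the $\Delta$-ary tree exhibits reconstruction, and for every integer $\Delta<\Delta_{\rm KS}(\beta,\phi)$ it exhibits non-reconstruction.
   Context: For integers $\Delta,h>0$, let $T=T_h=(V,E)$ be the $\Delta$-ary tree of height $h$ rooted at $r$: every vertex at distance less than $h$ from $r$ has exactly $\Delta$ children. Let $\{J_e\}_{e\in E}$ be i.i.d. random variables with law $\phi$. The random Gibbs distribution $\mu=\mu_{\beta,\phi}$ on $\{\pm1\}^V$ is $$\mu(\sigma)\propto\exp\Big(\beta\sum_{\{u,w\}\in E}\mathbf{1}\{\sigma(u)=\sigma(w)\}\,J_{\{u,w\}}\Big).$$ Let $\mu_h$ be the marginal of $\mu$ on the set $\Lambda$ of vertices at distance $h$ from $r$, and let $\mu_h(\cdot\mid\sigma(r)=s)$ be this marginal conditioned on the root spin being $s$. The measure exhibits reconstruction if $$\limsup_{h\to\infty}\mathbb{E}\big[\|\mu_h(\cdot\mid\sigma(r)=+1)-\mu_h(\cdot\mid\sigma(r)=-1)\|_{\rm TV}\big]>0,$$ where the expectation is over the couplings $\{J_e\}$. It exhibits non-reconstruction if this limit equals $0$. *)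

theory Defs
  imports "HOL-Probability.Probability"
begin

text \<open>
  A vertex of the \<open>\<Delta>\<close>-ary tree is the list of child indices on the path from the root \<open>[]\<close> to it,
  so its distance from the root is its length.
\<close>

definition tree_vertices :: "nat \<Rightarrow> nat \<Rightarrow> nat list set" where
  "tree_vertices \<Delta> h = {v. set v \<subseteq> {..<\<Delta>} \<and> length v \<le> h}"

definition tree_edges :: "nat \<Rightarrow> nat \<Rightarrow> nat list set set" where
  "tree_edges \<Delta> h =
     {{v, v @ [i]} | v i. v \<in> tree_vertices \<Delta> h \<and> length v < h \<and> i < \<Delta>}"

definition tree_leaves :: "nat \<Rightarrow> nat \<Rightarrow> nat list set" where
  "tree_leaves \<Delta> h = {v \<in> tree_vertices \<Delta> h. length v = h}"

definition spin_configs :: "'v set \<Rightarrow> ('v \<Rightarrow> int) set" where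
  "spin_configs V = V \<rightarrow>\<^sub>E {-1, 1}"

definition gibbs_weight ::
  "real \<Rightarrow> 'v set set \<Rightarrow> ('v set \<Rightarrow> real) \<Rightarrow> ('v \<Rightarrow> int) \<Rightarrow> real" where
  "gibbs_weight \<beta> E J \<sigma> =
     exp (\<beta> * (\<Sum>e\<in>E. of_bool (\<forall>u\<in>e. \<forall>w\<in>e. \<sigma> u = \<sigma> w) * J e))"

definition gibbs_pmf ::
  "real \<Rightarrow> 'v set \<Rightarrow> 'v set set \<Rightarrow> ('v set \<Rightarrow> real) \<Rightarrow> ('v \<Rightarrow> int) pmf" where
  "gibbs_pmf \<beta> V E J =
     embed_pmf (\<lambda>\<sigma>. if \<sigma> \<in> spin_configs V
                     then gibbs_weight \<beta> E J \<sigma> / (\<Sum>\<tau>\<in>spin_configs V. gibbs_weight \<beta> E J \<tau>)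
                     else 0)"

lemma finite_spin_configs: "finite V \<Longrightarrow> finite (spin_configs V)"
  unfolding spin_configs_def by (intro finite_PiE) auto

lemma spin_configs_nonempty: "spin_configs V \<noteq> {}"
  unfolding spin_configs_def by (simp add: PiE_eq_empty_iff)

lemma gibbs_weight_pos: "gibbs_weight \<beta> E J \<sigma> > 0"
  unfolding gibbs_weight_def by simp

lemma pmf_gibbs_pmf:
  assumes "finite V"
  shows "pmf (gibbs_pmf \<beta> V E J) \<sigma> =
    (if \<sigma> \<in> spin_configs V
     then gibbs_weight \<beta> E J \<sigma> / (\<Sum>\<tau>\<in>spin_configs V. gibbs_weight \<beta> E J \<tau>)
     else 0)"
proof -
  let ?Z = "\<Sum>\<tau>\<in>spin_configs V. gibbs_weight \<beta> E J \<tau>"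
  let ?f = "\<lambda>\<sigma>. if \<sigma> \<in> spin_configs V then gibbs_weight \<beta> E J \<sigma> / ?Z else 0"
  have fin: "finite (spin_configs V)"
    using assms by (rule finite_spin_configs)
  have Z: "?Z > 0"
    using fin spin_configs_nonempty by (intro sum_pos gibbs_weight_pos)
  have nonneg: "0 \<le> ?f \<tau>" for \<tau>
    using Z gibbs_weight_pos[of \<beta> E J \<tau>] by simp
  have "(\<integral>\<^sup>+\<tau>. ennreal (?f \<tau>) \<partial>count_space UNIV) = (\<Sum>\<tau>\<in>spin_configs V. ennreal (?f \<tau>))"
    using fin by (intro nn_integral_count_space'[where A = "spin_configs V"]) auto
  also have "\<dots> = ennreal (\<Sum>\<tau>\<in>spin_configs V. ?f \<tau>)"
    using nonneg by (intro sum_ennreal) blast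
  also have "(\<Sum>\<tau>\<in>spin_configs V. ?f \<tau>) = 1"
    using Z by (simp add: sum_divide_distrib[symmetric])
  finally have "(\<integral>\<^sup>+\<tau>. ennreal (?f \<tau>) \<partial>count_space UNIV) = 1"
    by simp
  then show ?thesis
    unfolding gibbs_pmf_def using nonneg by (subst pmf_embed_pmf) auto
qed

definition tv_dist :: "'a pmf \<Rightarrow> 'a pmf \<Rightarrow> real" where
  "tv_dist p q = (SUP A. \<bar>measure_pmf.prob p A - measure_pmf.prob q A\<bar>)"

definition leaf_law ::
  "real \<Rightarrow> nat \<Rightarrow> nat \<Rightarrow> (nat list set \<Rightarrow> real) \<Rightarrow> int \<Rightarrow> (nat list \<Rightarrow> int) pmf" where
  "leaf_law \<beta> \<Delta> h J s =
     map_pmf (\<lambda>\<sigma>. restrict \<sigma> (tree_leaves \<Delta> h))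
       (cond_pmf (gibbs_pmf \<beta> (tree_vertices \<Delta> h) (tree_edges \<Delta> h) J) {\<sigma>. \<sigma> [] = s})"

definition expected_tv :: "real \<Rightarrow> real measure \<Rightarrow> nat \<Rightarrow> nat \<Rightarrow> real" where
  "expected_tv \<beta> \<phi> \<Delta> h =
     (\<integral>J. tv_dist (leaf_law \<beta> \<Delta> h J 1) (leaf_law \<beta> \<Delta> h J (-1))
        \<partial>(\<Pi>\<^sub>M e\<in>tree_edges \<Delta> h. \<phi>))"

definition reconstruction :: "real \<Rightarrow> real measure \<Rightarrow> nat \<Rightarrow> bool" where
  "reconstruction \<beta> \<phi> \<Delta> \<longleftrightarrow> limsup (\<lambda>h. ereal (expected_tv \<beta> \<phi> \<Delta> h)) > 0"

definition non_reconstruction :: "real \<Rightarrow> real measure \<Rightarrow> nat \<Rightarrow> bool" where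
  "non_reconstruction \<beta> \<phi> \<Delta> \<longleftrightarrow> limsup (\<lambda>h. ereal (expected_tv \<beta> \<phi> \<Delta> h)) = 0"

text \<open>
  The threshold is extended-real valued: if the expectation vanishes (\<open>J = 0\<close> almost surely), it is
  \<open>\<infinity>\<close>, whereas the inverse on the reals would give \<open>0\<close>.
\<close>

definition Delta_KS :: "real \<Rightarrow> real measure \<Rightarrow> ereal" where
  "Delta_KS \<beta> \<phi> =
     inverse (ereal (\<integral>x. ((1 - exp (\<beta> * x)) / (1 + exp (\<beta> * x)))\<^sup>2 \<partial>\<phi>))"

end

theory Submission
  imports Defs
begin

text \<open>
  On a tree the Gibbs measure is a broadcast process: along an edge with coupling \<open>J\<close> the spin is
  kept with probability \<open>(1 + \<theta>) / 2\<close>, where \<open>\<theta> = (exp (\<beta> J) - 1) / (exp (\<beta> J) + 1)\<close>. Let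
  \<open>A\<close> be the sum over the leaves of the product of \<open>\<theta>\<^sup>2\<close> along the path to the root; since the
  couplings are independent, its expectation is \<open>(\<Delta> m) ^ h\<close> with \<open>m = E \<theta>\<^sup>2 = 1 / \<Delta>\<^sub>K\<^sub>S\<close>.

  Below the threshold, the symmetrized chi-square distance of the two conditional leaf laws is
  subadditive over the subtrees of the root, thanks to the global spin flip symmetry, and it is
  multiplied by exactly \<open>\<theta>\<^sup>2\<close> along an edge. Hence it is at most \<open>A\<close>, and it controls the total variation
  distance.

  Above the threshold, the leaves are tested with the sum of the leaf spins weighted by the
  products of the \<open>\<theta>\<close> along their paths. Its mean is \<open>\<plusminus>A\<close>. Its second moment \<open>B\<close> is, like \<open>A\<close>,
  affine in each \<open>\<theta>\<^sup>2\<close>, so \<open>E B\<close> is obtained by replacing every \<open>\<theta>\<^sup>2\<close> by \<open>m\<close>, which gives at most a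
  constant times \<open>(E A)\<^sup>2\<close>.
\<close>

section \<open>Broadcasting on the tree\<close>

text \<open>A vertex is its path from the root, so prefixing \<open>i\<close> places a tree of
  smaller height below the \<open>i\<close>-th child. All inductions on the height peel off the root
  in this way.\<close>

definition subtree :: "nat \<Rightarrow> (nat list \<Rightarrow> 'a) \<Rightarrow> nat list \<Rightarrow> 'a" where
  "subtree i f = (\<lambda>v. f (i # v))"

definition graft :: "nat \<Rightarrow> nat list set \<Rightarrow> nat list set" where
  "graft \<Delta> V = (\<Union>i<\<Delta>. (#) i ` V)"

lemma tree_vertices_0: "tree_vertices \<Delta> 0 = {[]}"
  by (auto simp: tree_vertices_def)

lemma tree_vertices_Suc: "tree_vertices \<Delta> (Suc h) = insert [] (graft \<Delta> (tree_vertices \<Delta> h))"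
proof (intro set_eqI)
  fix v show "v \<in> tree_vertices \<Delta> (Suc h) \<longleftrightarrow> v \<in> insert [] (graft \<Delta> (tree_vertices \<Delta> h))"
    by (cases v) (auto simp: tree_vertices_def graft_def)
qed

lemma tree_leaves_0: "tree_leaves \<Delta> 0 = {[]}"
  by (auto simp: tree_leaves_def tree_vertices_def)

lemma tree_leaves_Suc: "tree_leaves \<Delta> (Suc h) = graft \<Delta> (tree_leaves \<Delta> h)"
proof (intro set_eqI)
  fix v show "v \<in> tree_leaves \<Delta> (Suc h) \<longleftrightarrow> v \<in> graft \<Delta> (tree_leaves \<Delta> h)"
    by (cases v) (auto simp: tree_leaves_def tree_vertices_def graft_def)
qed

lemma finite_graft: "finite V \<Longrightarrow> finite (graft \<Delta> V)"
  by (simp add: graft_def)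

lemma finite_tree_vertices: "finite (tree_vertices \<Delta> h)"
  by (induction h) (simp_all add: tree_vertices_0 tree_vertices_Suc finite_graft)

lemma finite_tree_leaves: "finite (tree_leaves \<Delta> h)"
  by (simp add: tree_leaves_def finite_tree_vertices)

lemma Nil_in_tree_vertices: "[] \<in> tree_vertices \<Delta> h"
  by (simp add: tree_vertices_def)

lemma tree_leaves_subset: "tree_leaves \<Delta> h \<subseteq> tree_vertices \<Delta> h"
  by (auto simp: tree_leaves_def)

lemma Nil_notin_graft: "[] \<notin> graft \<Delta> V"
  by (auto simp: graft_def)

lemma Cons_in_graft: "i # v \<in> graft \<Delta> V \<longleftrightarrow> i < \<Delta> \<and> v \<in> V"
  by (auto simp: graft_def)

lemma graft_cases:
  assumes "w \<in> graft \<Delta> V"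
  obtains i v where "w = i # v" "i < \<Delta>" "v \<in> V"
  using assms by (auto simp: graft_def)

lemma prod_graft:
  assumes "finite V"
  shows "(\<Prod>v\<in>graft \<Delta> V. f v) = (\<Prod>i<\<Delta>. \<Prod>v\<in>V. f (i # v))"
proof -
  have "(\<Prod>v\<in>graft \<Delta> V. f v) = (\<Prod>i<\<Delta>. \<Prod>v\<in>(#) i ` V. f v)"
    unfolding graft_def using assms by (intro prod.UNION_disjoint) auto
  also have "\<dots> = (\<Prod>i<\<Delta>. \<Prod>v\<in>V. f (i # v))"
    by (intro prod.cong refl prod.reindex_cong[where l = "(#) _"]) (auto simp: inj_on_def)
  finally show ?thesis .
qed

text \<open>A configuration on the grafted set is an independent choice of one configuration on
  \<open>V\<close> per child. Sums over it thus become sums over a \<open>PiE\<close> space, where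
  products over the children factorize.\<close>

lemma sum_spin_configs_graft:
  "(\<Sum>\<tau>\<in>spin_configs (graft \<Delta> V). F (\<lambda>i\<in>{..<\<Delta>}. restrict (subtree i \<tau>) V)) =
    (\<Sum>g\<in>{..<\<Delta>} \<rightarrow>\<^sub>E spin_configs V. F g)"
proof (rule sum.reindex_bij_witness[where
      i = "\<lambda>g. \<lambda>w\<in>graft \<Delta> V. g (hd w) (tl w)" and
      j = "\<lambda>\<tau>. \<lambda>i\<in>{..<\<Delta>}. restrict (subtree i \<tau>) V"])
  fix \<tau> assume \<tau>: "\<tau> \<in> spin_configs (graft \<Delta> V)"
  show "(\<lambda>w\<in>graft \<Delta> V. (\<lambda>i\<in>{..<\<Delta>}. restrict (subtree i \<tau>) V) (hd w) (tl w)) = \<tau>"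
  proof
    fix w show "(\<lambda>w\<in>graft \<Delta> V. (\<lambda>i\<in>{..<\<Delta>}. restrict (subtree i \<tau>) V) (hd w) (tl w)) w = \<tau> w"
    proof (cases "w \<in> graft \<Delta> V")
      case True
      then show ?thesis by (rule graft_cases) (use True in \<open>simp add: subtree_def\<close>)
    next
      case False
      then show ?thesis using PiE_arb[OF \<tau>[unfolded spin_configs_def] False] by simp
    qed
  qed
  have "restrict (subtree i \<tau>) V \<in> spin_configs V" if "i < \<Delta>" for i
    unfolding spin_configs_def
  proof (rule PiE_I)
    fix v assume "v \<in> V"
    with that have "i # v \<in> graft \<Delta> V" by (simp add: Cons_in_graft)
    with \<tau> have "\<tau> (i # v) \<in> {-1, 1}" unfolding spin_configs_def by (rule PiE_mem)
    with \<open>v \<in> V\<close> show "restrict (subtree i \<tau>) V v \<in> {-1, 1}" by (simp add: subtree_def)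
  qed simp
  then show "(\<lambda>i\<in>{..<\<Delta>}. restrict (subtree i \<tau>) V) \<in> {..<\<Delta>} \<rightarrow>\<^sub>E spin_configs V"
    by simp
next
  fix g assume g: "g \<in> {..<\<Delta>} \<rightarrow>\<^sub>E spin_configs V"
  have gi: "g i \<in> V \<rightarrow>\<^sub>E {-1, 1}" if "i < \<Delta>" for i
    using PiE_mem[OF g] that by (simp add: spin_configs_def)
  show "(\<lambda>i\<in>{..<\<Delta>}. restrict (subtree i (\<lambda>w\<in>graft \<Delta> V. g (hd w) (tl w))) V) = g"
  proof (intro ext)
    fix i v
    show "(\<lambda>i\<in>{..<\<Delta>}. restrict (subtree i (\<lambda>w\<in>graft \<Delta> V. g (hd w) (tl w))) V) i v = g i v"
    proof (cases "i < \<Delta>")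
      case True
      then show ?thesis
        using PiE_arb[OF gi[OF True]] by (simp add: subtree_def Cons_in_graft restrict_def)
    next
      case False
      then show ?thesis using PiE_arb[OF g] by simp
    qed
  qed
  show "(\<lambda>w\<in>graft \<Delta> V. g (hd w) (tl w)) \<in> spin_configs (graft \<Delta> V)"
    unfolding spin_configs_def
  proof (rule PiE_I)
    fix w assume w: "w \<in> graft \<Delta> V"
    then obtain i v where iv: "w = i # v" "i < \<Delta>" "v \<in> V"
      by (rule graft_cases)
    then show "(\<lambda>w\<in>graft \<Delta> V. g (hd w) (tl w)) w \<in> {-1, 1}"
      using PiE_mem[OF gi] w by simp
  qed simp
qed simp

text \<open>The binary symmetric channel with second eigenvalue \<theta>; it depends on the two
  spins only through their product.\<close>

definition edge_kernel :: "real \<Rightarrow> int \<Rightarrow> int \<Rightarrow> real" where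
  "edge_kernel \<theta> s s' = (1 + of_int (s * s') * \<theta>) / 2"

text \<open>The probability of the leaf spins \<tau> given root spin \<open>s\<close>: the subtrees
  are independent given the root, and each child spin is summed out. The entry of \<theta> at a
  vertex belongs to the edge towards its parent.\<close>

primrec leaf_prob ::
  "nat \<Rightarrow> nat \<Rightarrow> (nat list \<Rightarrow> real) \<Rightarrow> int \<Rightarrow> (nat list \<Rightarrow> int) \<Rightarrow> real" where
  "leaf_prob \<Delta> 0 \<theta> s \<tau> = of_bool (\<tau> [] = s)"
| "leaf_prob \<Delta> (Suc h) \<theta> s \<tau> =
    (\<Prod>i<\<Delta>. \<Sum>s'\<in>{-1, 1}.
      edge_kernel (\<theta> [i]) s s' * leaf_prob \<Delta> h (subtree i \<theta>) s' (subtree i \<tau>))"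

text \<open>The law of the leaves below the child \<open>i\<close> given the spin of the root, one
  step above that child.\<close>

definition branch_prob ::
  "nat \<Rightarrow> nat \<Rightarrow> (nat list \<Rightarrow> real) \<Rightarrow> nat \<Rightarrow> int \<Rightarrow> (nat list \<Rightarrow> int) \<Rightarrow> real" where
  "branch_prob \<Delta> h \<theta> i s \<tau> =
    (\<Sum>s'\<in>{-1, 1}. edge_kernel (\<theta> [i]) s s' * leaf_prob \<Delta> h (subtree i \<theta>) s' \<tau>)"

lemma leaf_prob_cong:
  "(\<And>v. v \<in> tree_leaves \<Delta> h \<Longrightarrow> \<tau> v = \<tau>' v) \<Longrightarrow> leaf_prob \<Delta> h \<theta> s \<tau> = leaf_prob \<Delta> h \<theta> s \<tau>'"
proof (induction h arbitrary: \<theta> s \<tau> \<tau>')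
  case 0
  then show ?case by (simp add: tree_leaves_0)
next
  case (Suc h)
  have "leaf_prob \<Delta> h \<theta>' s' (subtree i \<tau>) = leaf_prob \<Delta> h \<theta>' s' (subtree i \<tau>')"
    if "i < \<Delta>" for i s' \<theta>'
    using Suc.prems that
    by (intro Suc.IH) (auto simp: subtree_def tree_leaves_Suc Cons_in_graft)
  then show ?case by simp
qed

text \<open>Exhibits the leaf law as a product measure. The restriction puts each factor into the
  shape that \<open>sum_leaf_configs_Suc\<close> expects.\<close>

lemma leaf_prob_Suc_branch:
  "leaf_prob \<Delta> (Suc h) \<theta> s \<tau> =
    (\<Prod>i<\<Delta>. branch_prob \<Delta> h \<theta> i s (restrict (subtree i \<tau>) (tree_leaves \<Delta> h)))"
proof -
  have "leaf_prob \<Delta> h \<theta>' s' (restrict (subtree i \<tau>) (tree_leaves \<Delta> h)) =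
      leaf_prob \<Delta> h \<theta>' s' (subtree i \<tau>)" for \<theta>' s' i
    by (rule leaf_prob_cong) simp
  then show ?thesis
    by (simp add: branch_prob_def)
qed

lemma sum_leaf_configs_Suc:
  "(\<Sum>\<tau>\<in>spin_configs (tree_leaves \<Delta> (Suc h)).
      F (\<lambda>i\<in>{..<\<Delta>}. restrict (subtree i \<tau>) (tree_leaves \<Delta> h))) =
    (\<Sum>g\<in>{..<\<Delta>} \<rightarrow>\<^sub>E spin_configs (tree_leaves \<Delta> h). F g)"
  unfolding tree_leaves_Suc by (rule sum_spin_configs_graft)

lemma edge_kernel_flip: "edge_kernel \<theta> (- s) (- s') = edge_kernel \<theta> s s'"
  by (simp add: edge_kernel_def)

text \<open>Flipping all spins leaves every product of neighbouring spins, and hence every channel,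
  unchanged.\<close>

lemma leaf_prob_flip:
  "leaf_prob \<Delta> h \<theta> (- s) (\<lambda>v. - \<tau> v) = leaf_prob \<Delta> h \<theta> s \<tau>"
proof (induction h arbitrary: \<theta> s \<tau>)
  case 0
  then show ?case by simp
next
  case (Suc h)
  have "(\<Sum>s'\<in>{-1, 1}. edge_kernel \<theta>' (- s) s' * leaf_prob \<Delta> h \<theta>'' s' (subtree i (\<lambda>v. - \<tau> v))) =
     (\<Sum>s'\<in>{-1, 1}. edge_kernel \<theta>' s s' * leaf_prob \<Delta> h \<theta>'' s' (subtree i \<tau>))" for i \<theta>' \<theta>''
    using Suc.IH[of \<theta>'' 1 "subtree i \<tau>"] Suc.IH[of \<theta>'' "-1" "subtree i \<tau>"]
      edge_kernel_flip[of \<theta>' s 1] edge_kernel_flip[of \<theta>' s "-1"]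
    by (simp add: subtree_def)
  then show ?case by simp
qed

text \<open>Flipping the leaves permutes the configurations and exchanges the two root conditions.
  This supplies the swap symmetry needed for subadditivity.\<close>

lemma sum_leaf_prob_flip:
  "(\<Sum>\<tau>\<in>spin_configs (tree_leaves \<Delta> h). F (leaf_prob \<Delta> h \<theta> 1 \<tau>) (leaf_prob \<Delta> h \<theta> (-1) \<tau>)) =
   (\<Sum>\<tau>\<in>spin_configs (tree_leaves \<Delta> h). F (leaf_prob \<Delta> h \<theta> (-1) \<tau>) (leaf_prob \<Delta> h \<theta> 1 \<tau>))"
proof (rule sum.reindex_bij_witness[where i = "\<lambda>\<tau>. \<lambda>v\<in>tree_leaves \<Delta> h. - \<tau> v"
      and j = "\<lambda>\<tau>. \<lambda>v\<in>tree_leaves \<Delta> h. - \<tau> v"])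
  let ?L = "tree_leaves \<Delta> h"
  fix \<tau> :: "nat list \<Rightarrow> int" assume \<tau>: "\<tau> \<in> spin_configs ?L"
  show "(\<lambda>v\<in>?L. - (\<lambda>v\<in>?L. - \<tau> v) v) = \<tau>"
    using \<tau> by (auto simp: spin_configs_def PiE_iff extensional_def)
  then show "(\<lambda>v\<in>?L. - (\<lambda>v\<in>?L. - \<tau> v) v) = \<tau>" .
  show "(\<lambda>v\<in>?L. - \<tau> v) \<in> spin_configs ?L"
    using \<tau> unfolding spin_configs_def by fastforce
  then show "(\<lambda>v\<in>?L. - \<tau> v) \<in> spin_configs ?L" .
  have "leaf_prob \<Delta> h \<theta> s (\<lambda>v\<in>?L. - \<tau> v) = leaf_prob \<Delta> h \<theta> (- s) \<tau>" for s
  proof -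
    have "leaf_prob \<Delta> h \<theta> s (\<lambda>v\<in>?L. - \<tau> v) = leaf_prob \<Delta> h \<theta> s (\<lambda>v. - \<tau> v)"
      by (rule leaf_prob_cong) simp
    also have "\<dots> = leaf_prob \<Delta> h \<theta> (- s) \<tau>"
      using leaf_prob_flip[of \<Delta> h \<theta> "- s" \<tau>] by simp
    finally show ?thesis .
  qed
  then show "F (leaf_prob \<Delta> h \<theta> (- 1) (\<lambda>v\<in>?L. - \<tau> v)) (leaf_prob \<Delta> h \<theta> 1 (\<lambda>v\<in>?L. - \<tau> v)) =
      F (leaf_prob \<Delta> h \<theta> 1 \<tau>) (leaf_prob \<Delta> h \<theta> (- 1) \<tau>)"
    by simp
qed

lemma sum_edge_kernel: "(\<Sum>s'\<in>{-1, 1}. edge_kernel \<theta> s s') = 1"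
  by (simp add: edge_kernel_def field_simps)

lemma edge_kernel_nonneg:
  assumes "\<bar>\<theta>\<bar> \<le> 1" "s \<in> {-1, 1}" "s' \<in> {-1, 1}"
  shows "0 \<le> edge_kernel \<theta> s s'"
  using assms by (auto simp: edge_kernel_def)

lemma leaf_prob_nonneg:
  "(\<And>v. \<bar>\<theta> v\<bar> \<le> 1) \<Longrightarrow> s \<in> {-1, 1} \<Longrightarrow> 0 \<le> leaf_prob \<Delta> h \<theta> s \<tau>"
proof (induction h arbitrary: \<theta> s \<tau>)
  case 0
  then show ?case by simp
next
  case (Suc h)
  have "\<bar>subtree i \<theta> v\<bar> \<le> 1" for i v
    using Suc.prems(1) by (simp add: subtree_def)
  then have "0 \<le> leaf_prob \<Delta> h (subtree i \<theta>) s' (subtree i \<tau>)" if "s' \<in> {-1, 1}" for i s'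
    using Suc.IH that by blast
  then show ?case
    unfolding leaf_prob.simps
    by (intro prod_nonneg ballI sum_nonneg mult_nonneg_nonneg edge_kernel_nonneg Suc.prems) auto
qed

lemma branch_prob_nonneg:
  assumes "\<And>v. \<bar>\<theta> v\<bar> \<le> 1" "s \<in> {-1, 1}"
  shows "0 \<le> branch_prob \<Delta> h \<theta> i s \<tau>"
  unfolding branch_prob_def using assms
  by (intro sum_nonneg mult_nonneg_nonneg edge_kernel_nonneg leaf_prob_nonneg)
    (auto simp: subtree_def)

lemma spin_configs_Nil: "spin_configs {[]::nat list} = {(\<lambda>v\<in>{[]}. -1), (\<lambda>v\<in>{[]}. 1)}"
  unfolding spin_configs_def PiE_over_singleton_iff by auto

lemma sum_spin_configs_Nil:
  "(\<Sum>\<tau>\<in>spin_configs {[]::nat list}. F (\<tau> [])) = F (-1) + F 1"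
proof -
  have "(\<lambda>v\<in>{[]::nat list}. -1 :: int) \<noteq> (\<lambda>v\<in>{[]}. 1)"
    by (auto simp: fun_eq_iff)
  then show ?thesis
    by (simp add: spin_configs_Nil)
qed

text \<open>Conditioning on the child spin: \<open>c\<close> holds the conditional expectations of
  \<open>F\<close>, and the channel averages them. It serves the total mass, the mean and the second
  moment alike.\<close>

lemma sum_branch_prob:
  assumes "\<And>s'. s' \<in> {-1, 1} \<Longrightarrow>
    (\<Sum>\<tau>\<in>spin_configs (tree_leaves \<Delta> h). leaf_prob \<Delta> h (subtree i \<theta>) s' \<tau> * F \<tau>) = c s'"
  shows "(\<Sum>\<tau>\<in>spin_configs (tree_leaves \<Delta> h). branch_prob \<Delta> h \<theta> i s \<tau> * F \<tau>) =
    (\<Sum>s'\<in>{-1, 1}. edge_kernel (\<theta> [i]) s s' * c s')"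
proof -
  have "(\<Sum>\<tau>\<in>spin_configs (tree_leaves \<Delta> h). branch_prob \<Delta> h \<theta> i s \<tau> * F \<tau>) =
    (\<Sum>\<tau>\<in>spin_configs (tree_leaves \<Delta> h). \<Sum>s'\<in>{-1, 1}.
      edge_kernel (\<theta> [i]) s s' * (leaf_prob \<Delta> h (subtree i \<theta>) s' \<tau> * F \<tau>))"
    unfolding branch_prob_def by (simp add: sum_distrib_right mult.assoc distrib_right)
  also have "\<dots> = (\<Sum>s'\<in>{-1, 1}. edge_kernel (\<theta> [i]) s s' *
      (\<Sum>\<tau>\<in>spin_configs (tree_leaves \<Delta> h). leaf_prob \<Delta> h (subtree i \<theta>) s' \<tau> * F \<tau>))"
    by (subst sum.swap) (simp only: sum_distrib_left)
  also have "\<dots> = (\<Sum>s'\<in>{-1, 1}. edge_kernel (\<theta> [i]) s s' * c s')"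
    using assms by (intro sum.cong refl) simp
  finally show ?thesis .
qed

lemma sum_leaf_prob:
  "s \<in> {-1, 1} \<Longrightarrow> (\<Sum>\<tau>\<in>spin_configs (tree_leaves \<Delta> h). leaf_prob \<Delta> h \<theta> s \<tau>) = 1"
proof (induction h arbitrary: \<theta> s)
  case 0
  then show ?case
    using sum_spin_configs_Nil[of "\<lambda>x. of_bool (x = s) :: real"] by (auto simp: tree_leaves_0)
next
  case (Suc h)
  let ?L = "tree_leaves \<Delta> h"
  have fin: "finite (spin_configs ?L)"
    by (intro finite_spin_configs finite_tree_leaves)
  have "(\<Sum>\<tau>\<in>spin_configs ?L. branch_prob \<Delta> h \<theta> i s \<tau>) = 1" for i
    using sum_branch_prob[where F = "\<lambda>_. 1" and c = "\<lambda>_. 1", of \<Delta> h i \<theta> s] Suc.IH sum_edge_kernel[of "\<theta> [i]" s]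
    by simp
  moreover have "(\<Sum>\<tau>\<in>spin_configs (tree_leaves \<Delta> (Suc h)). leaf_prob \<Delta> (Suc h) \<theta> s \<tau>) =
      (\<Sum>g\<in>{..<\<Delta>} \<rightarrow>\<^sub>E spin_configs ?L. \<Prod>i<\<Delta>. branch_prob \<Delta> h \<theta> i s (g i))"
    unfolding leaf_prob_Suc_branch
    using sum_leaf_configs_Suc[where F = "\<lambda>g. \<Prod>i<\<Delta>. branch_prob \<Delta> h \<theta> i s (g i)" and \<Delta> = \<Delta> and h = h] by simp
  moreover have "\<dots> = (\<Prod>i<\<Delta>. \<Sum>\<tau>\<in>spin_configs ?L. branch_prob \<Delta> h \<theta> i s \<tau>)"
    using fin by (subst prod_sum_PiE) simp_all
  ultimately show ?case by simp
qed

lemma sum_branch_prob_1: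
  assumes "s \<in> {-1, 1}"
  shows "(\<Sum>\<tau>\<in>spin_configs (tree_leaves \<Delta> h). branch_prob \<Delta> h \<theta> i s \<tau>) = 1"
  using sum_branch_prob[where F = "\<lambda>_. 1" and c = "\<lambda>_. 1", of \<Delta> h i \<theta> s]
    sum_leaf_prob sum_edge_kernel[of "\<theta> [i]" s]
  by simp

section \<open>Leaf laws of the Gibbs measure\<close>

text \<open>The probability of a full configuration given its root spin, with one channel for each
  non-root vertex; \<open>butlast v\<close> is the parent of \<open>v\<close>.\<close>

definition broadcast_prob :: "nat \<Rightarrow> nat \<Rightarrow> (nat list \<Rightarrow> real) \<Rightarrow> (nat list \<Rightarrow> int) \<Rightarrow> real" where
  "broadcast_prob \<Delta> h \<theta> \<sigma> =
    (\<Prod>v\<in>tree_vertices \<Delta> h - {[]}. edge_kernel (\<theta> v) (\<sigma> (butlast v)) (\<sigma> v))"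

lemma sum_spin_configs_insert:
  fixes F :: "('v \<Rightarrow> int) \<Rightarrow> real"
  assumes "finite V" "a \<notin> V" "s \<in> {-1, 1}"
  shows "(\<Sum>\<sigma>\<in>spin_configs (insert a V). of_bool (\<sigma> a = s) * F \<sigma>) =
    (\<Sum>\<sigma>\<in>spin_configs V. F (\<sigma>(a := s)))"
proof -
  have "(\<Sum>\<sigma>\<in>spin_configs (insert a V). of_bool (\<sigma> a = s) * F \<sigma>) =
      (\<Sum>\<sigma>\<in>{\<sigma> \<in> spin_configs (insert a V). \<sigma> a = s}. F \<sigma>)"
    using assms(1) by (intro sum.mono_neutral_cong_right finite_spin_configs) auto
  also have "\<dots> = (\<Sum>\<sigma>\<in>spin_configs V. F (\<sigma>(a := s)))"
  proof (rule sum.reindex_bij_witness[where i = "\<lambda>\<sigma>. \<sigma>(a := s)" and j = "\<lambda>\<sigma>. \<sigma>(a := undefined)"])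
    fix \<sigma> assume \<sigma>: "\<sigma> \<in> {\<sigma> \<in> spin_configs (insert a V). \<sigma> a = s}"
    then show "\<sigma>(a := undefined, a := s) = \<sigma>"
      by auto
    then show "F (\<sigma>(a := undefined, a := s)) = F \<sigma>"
      by simp
    show "\<sigma>(a := undefined) \<in> spin_configs V"
      using \<sigma> assms(2) unfolding spin_configs_def by (intro fun_upd_in_PiE) auto
  next
    fix \<sigma> :: "'v \<Rightarrow> int" assume \<sigma>: "\<sigma> \<in> spin_configs V"
    then show "\<sigma>(a := s, a := undefined) = \<sigma>"
      using assms(2) PiE_arb[OF \<sigma>[unfolded spin_configs_def] assms(2)] by auto
    show "\<sigma>(a := s) \<in> {\<sigma> \<in> spin_configs (insert a V). \<sigma> a = s}"
      using \<sigma> assms(3) unfolding spin_configs_def by (auto intro!: PiE_fun_upd)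
  qed
  finally show ?thesis .
qed

text \<open>Summing out the interior spins. Once the root spin is fixed, both the leaf constraint
  and the product of channels split over the subtrees of the root, so the sum factorizes and the
  induction hypothesis applies in each subtree.\<close>

lemma sum_broadcast_prob:
  "s \<in> {-1, 1} \<Longrightarrow>
    (\<Sum>\<sigma>\<in>spin_configs (tree_vertices \<Delta> h).
      of_bool (\<sigma> [] = s) * (of_bool (\<forall>v\<in>tree_leaves \<Delta> h. \<sigma> v = \<tau> v) * broadcast_prob \<Delta> h \<theta> \<sigma>)) =
    leaf_prob \<Delta> h \<theta> s \<tau>"
proof (induction h arbitrary: s \<tau> \<theta>)
  case 0
  have "(\<Sum>\<sigma>\<in>spin_configs {[]::nat list}. of_bool (\<sigma> [] = s) * (of_bool (\<sigma> [] = \<tau> []) :: real)) =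
    of_bool (\<tau> [] = s)"
    using 0 sum_spin_configs_Nil[of "\<lambda>x. of_bool (x = s) * (of_bool (x = \<tau> []) :: real)"] by auto
  then show ?case
    by (simp add: tree_vertices_0 tree_leaves_0 broadcast_prob_def)
next
  case (Suc h)
  let ?V = "tree_vertices \<Delta> h" and ?L = "tree_leaves \<Delta> h"
  \<comment> \<open>The share of the \<open>i\<close>-th subtree, including the edge that joins it
    to the root.\<close>
  define \<Psi> where "\<Psi> i \<rho> = of_bool (\<forall>v\<in>?L. \<rho> v = subtree i \<tau> v) *
      edge_kernel (\<theta> [i]) s (\<rho> []) * broadcast_prob \<Delta> h (subtree i \<theta>) \<rho>" for i and \<rho> :: "nat list \<Rightarrow> int"
  define F where "F \<sigma> = of_bool (\<forall>v\<in>tree_leaves \<Delta> (Suc h). \<sigma> v = \<tau> v) *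
      broadcast_prob \<Delta> (Suc h) \<theta> \<sigma>" for \<sigma> :: "nat list \<Rightarrow> int"
  have F: "F (\<sigma>([] := s)) = (\<Prod>i<\<Delta>. \<Psi> i (restrict (subtree i \<sigma>) ?V))" for \<sigma>
  proof -
    have V: "tree_vertices \<Delta> (Suc h) - {[]} = graft \<Delta> ?V"
      using Nil_notin_graft by (auto simp: tree_vertices_Suc)
    have "(of_bool (\<forall>v\<in>tree_leaves \<Delta> (Suc h). (\<sigma>([] := s)) v = \<tau> v) :: real) =
        (\<Prod>i<\<Delta>. of_bool (\<forall>v\<in>?L. restrict (subtree i \<sigma>) ?V v = subtree i \<tau> v))"
    proof -
      have "(\<forall>v\<in>tree_leaves \<Delta> (Suc h). (\<sigma>([] := s)) v = \<tau> v) \<longleftrightarrow>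
          (\<forall>i<\<Delta>. \<forall>v\<in>?L. restrict (subtree i \<sigma>) ?V v = subtree i \<tau> v)"
        unfolding tree_leaves_Suc graft_def using tree_leaves_subset[of \<Delta> h]
        by (auto simp: subtree_def)
      then show ?thesis
        by (auto simp: of_bool_def prod_zero_iff)
    qed
    moreover have "broadcast_prob \<Delta> (Suc h) \<theta> (\<sigma>([] := s)) =
      (\<Prod>i<\<Delta>. edge_kernel (\<theta> [i]) s (restrict (subtree i \<sigma>) ?V []) *
        broadcast_prob \<Delta> h (subtree i \<theta>) (restrict (subtree i \<sigma>) ?V))"
    proof -
      have "broadcast_prob \<Delta> (Suc h) \<theta> (\<sigma>([] := s)) = (\<Prod>i<\<Delta>. \<Prod>v\<in>?V.
          edge_kernel (\<theta> (i # v)) ((\<sigma>([] := s)) (butlast (i # v))) ((\<sigma>([] := s)) (i # v)))"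
        unfolding broadcast_prob_def V by (rule prod_graft[OF finite_tree_vertices])
      also have "\<dots> = (\<Prod>i<\<Delta>. edge_kernel (\<theta> [i]) s (restrict (subtree i \<sigma>) ?V []) *
        broadcast_prob \<Delta> h (subtree i \<theta>) (restrict (subtree i \<sigma>) ?V))"
      proof (rule prod.cong[OF refl])
        fix i
        have "butlast v \<in> ?V" if "v \<in> ?V" for v
          using that by (auto simp: tree_vertices_def dest: in_set_butlastD)
        then have "(\<Prod>v\<in>?V - {[]}. edge_kernel (\<theta> (i # v)) ((\<sigma>([] := s)) (butlast (i # v))) ((\<sigma>([] := s)) (i # v))) =
            broadcast_prob \<Delta> h (subtree i \<theta>) (restrict (subtree i \<sigma>) ?V)"
          unfolding broadcast_prob_def by (intro prod.cong refl) (auto simp: subtree_def)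
        then show "(\<Prod>v\<in>?V. edge_kernel (\<theta> (i # v)) ((\<sigma>([] := s)) (butlast (i # v))) ((\<sigma>([] := s)) (i # v))) =
            edge_kernel (\<theta> [i]) s (restrict (subtree i \<sigma>) ?V []) *
            broadcast_prob \<Delta> h (subtree i \<theta>) (restrict (subtree i \<sigma>) ?V)"
          by (subst prod.remove[OF finite_tree_vertices Nil_in_tree_vertices])
            (simp add: subtree_def Nil_in_tree_vertices)
      qed
      finally show ?thesis .
    qed
    ultimately show ?thesis
      unfolding F_def \<Psi>_def by (simp add: prod.distrib mult.assoc)
  qed
  \<comment> \<open>Splitting by the spin of the child, which takes exactly one of the two values,
    brings the sum into the form of the induction hypothesis.\<close>
  have \<Psi>: "(\<Sum>\<rho>\<in>spin_configs ?V. \<Psi> i \<rho>) =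
      (\<Sum>s'\<in>{-1, 1}. edge_kernel (\<theta> [i]) s s' * leaf_prob \<Delta> h (subtree i \<theta>) s' (subtree i \<tau>))" for i
  proof -
    have "(\<Sum>\<rho>\<in>spin_configs ?V. \<Psi> i \<rho>) = (\<Sum>\<rho>\<in>spin_configs ?V. \<Sum>s'\<in>{-1, 1}. edge_kernel (\<theta> [i]) s s' *
        (of_bool (\<rho> [] = s') * (of_bool (\<forall>v\<in>?L. \<rho> v = subtree i \<tau> v) * broadcast_prob \<Delta> h (subtree i \<theta>) \<rho>)))"
    proof (rule sum.cong[OF refl])
      fix \<rho> :: "nat list \<Rightarrow> int" assume "\<rho> \<in> spin_configs ?V"
      then have "\<rho> [] \<in> {-1, 1}"
        unfolding spin_configs_def using Nil_in_tree_vertices by (rule PiE_mem)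
      then show "\<Psi> i \<rho> = (\<Sum>s'\<in>{-1, 1}. edge_kernel (\<theta> [i]) s s' *
        (of_bool (\<rho> [] = s') * (of_bool (\<forall>v\<in>?L. \<rho> v = subtree i \<tau> v) * broadcast_prob \<Delta> h (subtree i \<theta>) \<rho>)))"
        unfolding \<Psi>_def by auto
    qed
    also have "\<dots> = (\<Sum>s'\<in>{-1, 1}. edge_kernel (\<theta> [i]) s s' * leaf_prob \<Delta> h (subtree i \<theta>) s' (subtree i \<tau>))"
      by (subst sum.swap) (simp only: sum_distrib_left[symmetric] Suc.IH cong: sum.cong)
    finally show ?thesis .
  qed
  have "(\<Sum>\<sigma>\<in>spin_configs (tree_vertices \<Delta> (Suc h)). of_bool (\<sigma> [] = s) * F \<sigma>) =
      (\<Sum>\<sigma>\<in>spin_configs (graft \<Delta> ?V). \<Prod>i<\<Delta>. \<Psi> i (restrict (subtree i \<sigma>) ?V))"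
    unfolding tree_vertices_Suc F[symmetric]
    using Suc.prems by (intro sum_spin_configs_insert finite_graft finite_tree_vertices Nil_notin_graft)
  also have "\<dots> = (\<Sum>g\<in>{..<\<Delta>} \<rightarrow>\<^sub>E spin_configs ?V. \<Prod>i<\<Delta>. \<Psi> i (g i))"
    using sum_spin_configs_graft[where F = "\<lambda>g. \<Prod>i<\<Delta>. \<Psi> i (g i)" and V = ?V and \<Delta> = \<Delta>] by simp
  also have "\<dots> = (\<Prod>i<\<Delta>. \<Sum>\<rho>\<in>spin_configs ?V. \<Psi> i \<rho>)"
    by (subst prod_sum_PiE) (simp_all add: finite_spin_configs finite_tree_vertices)
  finally show ?case
    unfolding F_def \<Psi> leaf_prob.simps .
qed

section \<open>Gibbs weights as broadcast probabilities\<close>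

definition parent_edge :: "'a list \<Rightarrow> 'a list set" where
  "parent_edge v = {butlast v, v}"

text \<open>Naming an edge by its lower endpoint turns couplings indexed by edges into correlations
  indexed by non-root vertices.\<close>

lemma tree_edges_eq: "tree_edges \<Delta> h = parent_edge ` (tree_vertices \<Delta> h - {[]})"
proof (intro set_eqI iffI)
  fix e assume "e \<in> tree_edges \<Delta> h"
  then obtain v i where "e = {v, v @ [i]}" "v \<in> tree_vertices \<Delta> h" "length v < h" "i < \<Delta>"
    unfolding tree_edges_def by blast
  then show "e \<in> parent_edge ` (tree_vertices \<Delta> h - {[]})"
    by (intro image_eqI[of _ _ "v @ [i]"]) (auto simp: parent_edge_def tree_vertices_def)
next
  fix e assume "e \<in> parent_edge ` (tree_vertices \<Delta> h - {[]})"
  then obtain w where w: "e = parent_edge w" "w \<in> tree_vertices \<Delta> h" "w \<noteq> []"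
    by blast
  then obtain v i where v: "w = v @ [i]" by (metis rev_exhaust)
  then have "e = {v, v @ [i]}" "v \<in> tree_vertices \<Delta> h" "length v < h" "i < \<Delta>"
    using w by (auto simp: parent_edge_def tree_vertices_def)
  then show "e \<in> tree_edges \<Delta> h"
    unfolding tree_edges_def by blast
qed

text \<open>Two distinct vertices with the same edge would be each other's parent, which their
  lengths forbid.\<close>

lemma parent_edge_inj: "inj_on parent_edge (V - {[]})"
proof (rule inj_onI)
  fix v w :: "'a list" assume "v \<in> V - {[]}" "w \<in> V - {[]}" and e: "parent_edge v = parent_edge w"
  then have ne: "v \<noteq> []" "w \<noteq> []" by auto
  show "v = w"
  proof (rule ccontr)
    assume "v \<noteq> w"
    with e have "v = butlast w" "w = butlast v"
      unfolding parent_edge_def by (auto simp: doubleton_eq_iff)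
    then have "length v = length w - 1" "length w = length v - 1"
      by (metis length_butlast)+
    with ne show False by (cases v; cases w) auto
  qed
qed

lemma finite_tree_edges: "finite (tree_edges \<Delta> h)"
  by (simp add: tree_edges_eq finite_tree_vertices)

text \<open>This is the hyperbolic tangent of \<beta> x / 2; its square is the integrand of
  \<open>Delta_KS\<close>.\<close>

definition edge_corr :: "real \<Rightarrow> real \<Rightarrow> real" where
  "edge_corr \<beta> x = (exp (\<beta> * x) - 1) / (exp (\<beta> * x) + 1)"

lemma abs_edge_corr: "\<bar>edge_corr \<beta> x\<bar> \<le> 1"
proof -
  have "exp (\<beta> * x) + 1 > 0" by (simp add: add_pos_pos)
  then show ?thesis
    by (simp add: edge_corr_def abs_le_iff pos_divide_le_eq pos_le_divide_eq flip: minus_divide_left)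
qed

definition vertex_corr :: "real \<Rightarrow> (nat list set \<Rightarrow> real) \<Rightarrow> nat list \<Rightarrow> real" where
  "vertex_corr \<beta> J v = edge_corr \<beta> (J (parent_edge v))"

text \<open>An edge has weight \<open>exp (\<beta> * x)\<close> on equal spins and 1 on different
  ones; dividing by the sum of these two weights yields the channel.\<close>

lemma exp_edge_kernel:
  assumes "s \<in> {-1, 1}" "s' \<in> {-1, 1}"
  shows "exp (\<beta> * (of_bool (s = s') * x)) = (1 + exp (\<beta> * x)) * edge_kernel (edge_corr \<beta> x) s s'"
proof -
  have "1 + exp (\<beta> * x) > 0" by (simp add: add_pos_pos)
  then show ?thesis using assms
    by (auto simp: edge_kernel_def edge_corr_def field_simps)
qed

text \<open>The prefactor does not depend on \<sigma>, so it disappears on normalization.\<close>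

lemma gibbs_weight_broadcast:
  assumes \<sigma>: "\<sigma> \<in> spin_configs (tree_vertices \<Delta> h)"
  shows "gibbs_weight \<beta> (tree_edges \<Delta> h) J \<sigma> =
    (\<Prod>v\<in>tree_vertices \<Delta> h - {[]}. 1 + exp (\<beta> * J (parent_edge v))) *
    broadcast_prob \<Delta> h (vertex_corr \<beta> J) \<sigma>"
proof -
  let ?V = "tree_vertices \<Delta> h - {[]}"
  have "gibbs_weight \<beta> (tree_edges \<Delta> h) J \<sigma> =
    (\<Prod>v\<in>?V. exp (\<beta> * (of_bool (\<sigma> (butlast v) = \<sigma> v) * J (parent_edge v))))"
    unfolding gibbs_weight_def tree_edges_eq sum_distrib_left exp_sum[OF finite_imageI[OF finite_Diff[OF finite_tree_vertices]]]
    by (subst prod.reindex[OF parent_edge_inj], unfold o_def, intro prod.cong refl)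
      (auto simp: parent_edge_def of_bool_def)
  also have "\<dots> = (\<Prod>v\<in>?V. (1 + exp (\<beta> * J (parent_edge v))) *
      edge_kernel (vertex_corr \<beta> J v) (\<sigma> (butlast v)) (\<sigma> v))"
  proof (rule prod.cong[OF refl])
    fix v assume v: "v \<in> ?V"
    then have "v \<in> tree_vertices \<Delta> h" "butlast v \<in> tree_vertices \<Delta> h"
      by (auto simp: tree_vertices_def dest: in_set_butlastD)
    then have "\<sigma> (butlast v) \<in> {-1, 1}" "\<sigma> v \<in> {-1, 1}"
      using \<sigma> unfolding spin_configs_def by (auto dest: PiE_mem)
    then show "exp (\<beta> * (of_bool (\<sigma> (butlast v) = \<sigma> v) * J (parent_edge v))) =
       (1 + exp (\<beta> * J (parent_edge v))) * edge_kernel (vertex_corr \<beta> J v) (\<sigma> (butlast v)) (\<sigma> v)"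
      unfolding vertex_corr_def by (rule exp_edge_kernel)
  qed
  finally show ?thesis
    by (simp add: prod.distrib broadcast_prob_def)
qed

text \<open>Conditioning the Gibbs measure on the root spin gives the broadcast law up to a constant
  \<open>c\<close>, made of the edge prefactors, the partition function and the probability of the
  root spin. It need not be computed: both sides have total mass 1, so \<open>c = 1\<close>.\<close>

lemma pmf_leaf_law:
  assumes s: "s \<in> {-1, 1}"
  shows "pmf (leaf_law \<beta> \<Delta> h J s) \<tau> =
    (if \<tau> \<in> spin_configs (tree_leaves \<Delta> h) then leaf_prob \<Delta> h (vertex_corr \<beta> J) s \<tau> else 0)"
proof -
  let ?V = "tree_vertices \<Delta> h" and ?L = "tree_leaves \<Delta> h" and ?E = "tree_edges \<Delta> h"
  let ?S = "{\<sigma> :: nat list \<Rightarrow> int. \<sigma> [] = s}"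
  let ?\<theta> = "vertex_corr \<beta> J"
  define G where "G = gibbs_pmf \<beta> ?V ?E J"
  define Z where "Z = (\<Sum>\<sigma>\<in>spin_configs ?V. gibbs_weight \<beta> ?E J \<sigma>)"
  define C where "C = (\<Prod>v\<in>?V - {[]}. 1 + exp (\<beta> * J (parent_edge v)))"
  have fin: "finite (spin_configs ?V)" "finite (spin_configs ?L)"
    by (intro finite_spin_configs finite_tree_vertices finite_tree_leaves)+
  have pmf_G: "pmf G \<sigma> = (if \<sigma> \<in> spin_configs ?V then gibbs_weight \<beta> ?E J \<sigma> / Z else 0)" for \<sigma>
    unfolding G_def Z_def by (rule pmf_gibbs_pmf[OF finite_tree_vertices])
  have Z: "Z > 0"
    unfolding Z_def using fin spin_configs_nonempty by (intro sum_pos gibbs_weight_pos)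
  \<comment> \<open>The constant configuration witnesses that the conditioning event has positive
    probability, as the lemmas on \<open>cond_pmf\<close> require.\<close>
  have "(\<lambda>v\<in>?V. s) \<in> spin_configs ?V"
    using s unfolding spin_configs_def by simp
  then have "(\<lambda>v\<in>?V. s) \<in> set_pmf G"
    using Z gibbs_weight_pos[of \<beta> ?E J "\<lambda>v\<in>?V. s"] by (simp add: set_pmf_iff pmf_G)
  then have ne: "set_pmf G \<inter> ?S \<noteq> {}"
    by (auto simp: Nil_in_tree_vertices)
  define c where "c = C / Z / measure G ?S"
  have main: "pmf (leaf_law \<beta> \<Delta> h J s) \<tau> = c * leaf_prob \<Delta> h ?\<theta> s \<tau>"
    if \<tau>: "\<tau> \<in> spin_configs ?L" for \<tau>
  proof -
    have sub: "set_pmf (cond_pmf G ?S) \<subseteq> spin_configs ?V"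
      unfolding set_cond_pmf[OF ne] by (auto simp: set_pmf_iff pmf_G split: if_splits)
    have "pmf (leaf_law \<beta> \<Delta> h J s) \<tau> =
        measure (cond_pmf G ?S) ((\<lambda>\<sigma>. restrict \<sigma> ?L) -` {\<tau>})"
      unfolding leaf_law_def G_def by (rule pmf_map)
    also have "\<dots> = measure (cond_pmf G ?S) {\<sigma> \<in> spin_configs ?V. restrict \<sigma> ?L = \<tau>}"
      using sub by (intro measure_pmf.finite_measure_eq_AE) (auto simp: AE_measure_pmf_iff)
    also have "\<dots> = (\<Sum>\<sigma>\<in>{\<sigma> \<in> spin_configs ?V. restrict \<sigma> ?L = \<tau>}. pmf (cond_pmf G ?S) \<sigma>)"
      using fin by (intro measure_measure_pmf_finite) simp
    also have "\<dots> = (\<Sum>\<sigma>\<in>spin_configs ?V. c *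
        (of_bool (\<sigma> [] = s) * (of_bool (\<forall>v\<in>?L. \<sigma> v = \<tau> v) * broadcast_prob \<Delta> h ?\<theta> \<sigma>)))"
    proof (rule sum.mono_neutral_cong_left)
      have restr: "restrict \<sigma> ?L = \<tau> \<longleftrightarrow> (\<forall>v\<in>?L. \<sigma> v = \<tau> v)" for \<sigma>
        using \<tau> PiE_arb[OF \<tau>[unfolded spin_configs_def]] by (auto simp: fun_eq_iff restrict_def)
      show "\<forall>\<sigma>\<in>spin_configs ?V - {\<sigma> \<in> spin_configs ?V. restrict \<sigma> ?L = \<tau>}. c *
        (of_bool (\<sigma> [] = s) * (of_bool (\<forall>v\<in>?L. \<sigma> v = \<tau> v) * broadcast_prob \<Delta> h ?\<theta> \<sigma>)) = 0"
        unfolding restr by auto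
      fix \<sigma> assume "\<sigma> \<in> {\<sigma> \<in> spin_configs ?V. restrict \<sigma> ?L = \<tau>}"
      then show "pmf (cond_pmf G ?S) \<sigma> = c *
        (of_bool (\<sigma> [] = s) * (of_bool (\<forall>v\<in>?L. \<sigma> v = \<tau> v) * broadcast_prob \<Delta> h ?\<theta> \<sigma>))"
        unfolding restr pmf_cond[OF ne] pmf_G
        by (simp add: c_def C_def gibbs_weight_broadcast)
    qed (use fin in auto)
    also have "\<dots> = c * leaf_prob \<Delta> h ?\<theta> s \<tau>"
      unfolding sum_distrib_left[symmetric] sum_broadcast_prob[OF s] ..
    finally show ?thesis .
  qed
  have outside: "set_pmf (leaf_law \<beta> \<Delta> h J s) \<subseteq> spin_configs ?L"
  proof -
    have "restrict \<sigma> ?L \<in> spin_configs ?L" if "\<sigma> \<in> spin_configs ?V" for \<sigma>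
      using that tree_leaves_subset[of \<Delta> h] unfolding spin_configs_def by auto
    then show ?thesis
      unfolding leaf_law_def G_def[symmetric] set_map_pmf set_cond_pmf[OF ne]
      by (auto simp: set_pmf_iff pmf_G split: if_splits)
  qed
  have "1 = (\<Sum>\<tau>\<in>spin_configs ?L. pmf (leaf_law \<beta> \<Delta> h J s) \<tau>)"
    using sum_pmf_eq_1[OF fin(2) outside] by simp
  also have "\<dots> = c * (\<Sum>\<tau>\<in>spin_configs ?L. leaf_prob \<Delta> h ?\<theta> s \<tau>)"
    unfolding sum_distrib_left by (intro sum.cong refl main)
  finally have "c = 1"
    using sum_leaf_prob[OF s] by simp
  with main outside show ?thesis
    by (auto simp: set_pmf_iff)
qed

text \<open>The difference of the two laws has total mass 0, so the indicator of an event may be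
  shifted by 1/2. The shifted indicator has absolute value 1/2 everywhere, and the bound is attained
  where the first law exceeds the second.\<close>

lemma tv_dist_finite:
  assumes "finite \<Omega>" "set_pmf p \<subseteq> \<Omega>" "set_pmf q \<subseteq> \<Omega>"
  shows "tv_dist p q = (\<Sum>x\<in>\<Omega>. \<bar>pmf p x - pmf q x\<bar>) / 2"
proof -
  define D where "D x = pmf p x - pmf q x" for x
  have prob: "measure_pmf.prob r A = (\<Sum>x\<in>\<Omega>. of_bool (x \<in> A) * pmf r x)"
    if "set_pmf r \<subseteq> \<Omega>" for r :: "'a pmf" and A
  proof -
    have "measure_pmf.prob r A = measure_pmf.prob r (A \<inter> \<Omega>)"
      using that by (intro measure_pmf.finite_measure_eq_AE) (auto simp: AE_measure_pmf_iff)
    also have "\<dots> = (\<Sum>x\<in>A \<inter> \<Omega>. pmf r x)"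
      using assms(1) by (intro measure_measure_pmf_finite) simp
    also have "\<dots> = (\<Sum>x\<in>\<Omega>. of_bool (x \<in> A) * pmf r x)"
      using assms(1) by (intro sum.mono_neutral_cong_left) auto
    finally show ?thesis .
  qed
  have D0: "(\<Sum>x\<in>\<Omega>. D x) = 0"
    using assms by (simp add: D_def sum_subtractf sum_pmf_eq_1)
  have diff: "measure_pmf.prob p A - measure_pmf.prob q A =
      (\<Sum>x\<in>\<Omega>. (of_bool (x \<in> A) - 1 / 2) * D x)" for A
    using D0 assms
    by (simp add: prob D_def left_diff_distrib right_diff_distrib sum_subtractf
        flip: sum_divide_distrib)
  have "(SUP A. \<bar>measure_pmf.prob p A - measure_pmf.prob q A\<bar>) = (\<Sum>x\<in>\<Omega>. \<bar>D x\<bar>) / 2"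
  proof (rule cSup_eq_maximum)
    have "(\<Sum>x\<in>\<Omega>. \<bar>D x\<bar>) / 2 = (\<Sum>x\<in>\<Omega>. (of_bool (x \<in> {x. D x > 0}) - 1 / 2) * D x)"
      unfolding sum_divide_distrib by (intro sum.cong refl) auto
    moreover have "\<dots> \<ge> 0"
      by (intro sum_nonneg) auto
    ultimately have "(\<Sum>x\<in>\<Omega>. \<bar>D x\<bar>) / 2 =
        \<bar>measure_pmf.prob p {x. D x > 0} - measure_pmf.prob q {x. D x > 0}\<bar>"
      unfolding diff by simp
    then show "(\<Sum>x\<in>\<Omega>. \<bar>D x\<bar>) / 2 \<in> range (\<lambda>A. \<bar>measure_pmf.prob p A - measure_pmf.prob q A\<bar>)"
      by blast
  next
    fix y assume "y \<in> range (\<lambda>A. \<bar>measure_pmf.prob p A - measure_pmf.prob q A\<bar>)"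
    then obtain A where "y = \<bar>\<Sum>x\<in>\<Omega>. (of_bool (x \<in> A) - 1 / 2) * D x\<bar>"
      unfolding diff by blast
    also have "\<dots> \<le> (\<Sum>x\<in>\<Omega>. \<bar>(of_bool (x \<in> A) - 1 / 2) * D x\<bar>)"
      by (rule sum_abs)
    also have "\<dots> = (\<Sum>x\<in>\<Omega>. \<bar>D x\<bar>) / 2"
      unfolding sum_divide_distrib by (intro sum.cong refl) (auto simp: abs_mult)
    finally show "y \<le> (\<Sum>x\<in>\<Omega>. \<bar>D x\<bar>) / 2" .
  qed
  then show ?thesis
    by (simp add: tv_dist_def D_def)
qed

section \<open>Total variation between the two conditional leaf laws\<close>

definition leaf_tv :: "nat \<Rightarrow> nat \<Rightarrow> (nat list \<Rightarrow> real) \<Rightarrow> real" where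
  "leaf_tv \<Delta> h \<theta> = (\<Sum>\<tau>\<in>spin_configs (tree_leaves \<Delta> h).
      \<bar>leaf_prob \<Delta> h \<theta> 1 \<tau> - leaf_prob \<Delta> h \<theta> (-1) \<tau>\<bar>) / 2"

lemma tv_dist_leaf_law:
  "tv_dist (leaf_law \<beta> \<Delta> h J 1) (leaf_law \<beta> \<Delta> h J (-1)) = leaf_tv \<Delta> h (vertex_corr \<beta> J)"
proof -
  let ?\<Omega> = "spin_configs (tree_leaves \<Delta> h)"
  have "finite ?\<Omega>"
    by (intro finite_spin_configs finite_tree_leaves)
  moreover have "set_pmf (leaf_law \<beta> \<Delta> h J s) \<subseteq> ?\<Omega>" if "s \<in> {-1, 1}" for s
    by (auto simp: set_pmf_iff pmf_leaf_law[OF that] split: if_splits)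
  ultimately show ?thesis
    by (subst tv_dist_finite[of ?\<Omega>]) (auto simp: leaf_tv_def pmf_leaf_law)
qed

section \<open>Subadditivity of the chi-square distance\<close>

text \<open>For nonnegative weights this is the chi-square distance of either law from the midpoint
  \<open>(p + q) / 2\<close>, also known as the triangular discrimination. Points where both weights
  vanish contribute 0, since division by 0 gives 0.\<close>

definition chi_sq :: "'a set \<Rightarrow> ('a \<Rightarrow> real) \<Rightarrow> ('a \<Rightarrow> real) \<Rightarrow> real" where
  "chi_sq \<Omega> p q = (\<Sum>x\<in>\<Omega>. (p x - q x)\<^sup>2 / (p x + q x)) / 2"

text \<open>Both sides are expressed through the two product masses \<open>u\<close> and
  \<open>w\<close> and the common quantity \<open>k\<close>: the squares on the left become
  \<open>u\<^sup>2 - 4 * k\<close> and \<open>w\<^sup>2 - 4 * k\<close>, and the right side is twice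
  their sum over \<open>u + w\<close>.\<close>

lemma chi_sq_term_symmetrized:
  fixes p q p' q' :: real
  assumes nn: "0 \<le> p" "0 \<le> q" "0 \<le> p'" "0 \<le> q'"
  shows "(p * p' - q * q')\<^sup>2 / (p * p' + q * q') + (q * p' - p * q')\<^sup>2 / (q * p' + p * q') \<le>
    (p - q)\<^sup>2 / (p + q) * (p' + q') + (p' - q')\<^sup>2 / (p' + q') * (p + q)"
proof (cases "p + q = 0 \<or> p' + q' = 0")
  case True
  then show ?thesis
    using nn by (auto simp: add_nonneg_eq_0_iff)
next
  case False
  define u where "u = p * p' + q * q'"
  define w where "w = q * p' + p * q'"
  define k where "k = p * q * p' * q'"
  have nonneg: "u \<ge> 0" "w \<ge> 0" "k \<ge> 0"
    using nn by (simp_all add: u_def w_def k_def)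
  have pos: "p + q > 0" "p' + q' > 0"
    using False nn by auto
  have uw: "u + w = (p + q) * (p' + q')"
    by (simp add: u_def w_def algebra_simps)
  have x: "(p * p' - q * q')\<^sup>2 = u\<^sup>2 - 4 * k" and y: "(q * p' - p * q')\<^sup>2 = w\<^sup>2 - 4 * k"
    by (simp_all add: u_def w_def k_def power2_eq_square algebra_simps)
  have uw_pos: "u + w > 0"
    unfolding uw using pos by simp
  have "(p - q)\<^sup>2 / (p + q) * (p' + q') + (p' - q')\<^sup>2 / (p' + q') * (p + q) =
      ((p - q)\<^sup>2 * (p' + q')\<^sup>2 + (p' - q')\<^sup>2 * (p + q)\<^sup>2) / (u + w)"
    unfolding uw using pos by (simp add: field_simps power2_eq_square)
  also have "(p - q)\<^sup>2 * (p' + q')\<^sup>2 + (p' - q')\<^sup>2 * (p + q)\<^sup>2 =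
      2 * ((p * p' - q * q')\<^sup>2 + (q * p' - p * q')\<^sup>2)"
    by (simp add: power2_eq_square algebra_simps)
  finally have rhs: "(p - q)\<^sup>2 / (p + q) * (p' + q') + (p' - q')\<^sup>2 / (p' + q') * (p + q) =
      2 * ((u\<^sup>2 - 4 * k) + (w\<^sup>2 - 4 * k)) / (u + w)"
    by (simp only: x y)
  \<comment> \<open>This is Chebyshev's sum inequality for the maps \<open>x\<close> and
    \<open>x - 4 * k / x\<close>, which both increase for \<open>x > 0\<close>; below, the gap is
    computed explicitly.\<close>
  have "(u\<^sup>2 - 4 * k) / u + (w\<^sup>2 - 4 * k) / w \<le> 2 * ((u\<^sup>2 - 4 * k) + (w\<^sup>2 - 4 * k)) / (u + w)"
  proof (cases "u = 0 \<or> w = 0")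
    case True
    \<comment> \<open>If a denominator vanishes, so does its numerator, and the convention for
      division by 0 loses nothing.\<close>
    have "(p * p' - q * q')\<^sup>2 = 0" if "u = 0"
      using that nn by (auto simp: u_def add_nonneg_eq_0_iff)
    moreover have "(q * p' - p * q')\<^sup>2 = 0" if "w = 0"
      using that nn by (auto simp: w_def add_nonneg_eq_0_iff)
    moreover have "u\<^sup>2 - 4 * k \<ge> 0" "w\<^sup>2 - 4 * k \<ge> 0"
      by (simp_all flip: x y)
    ultimately show ?thesis
      using True nonneg unfolding x y by (auto simp: divide_right_mono)
  next
    case False
    with nonneg have "u > 0" "w > 0" by auto
    then have "2 * ((u\<^sup>2 - 4 * k) + (w\<^sup>2 - 4 * k)) / (u + w) - ((u\<^sup>2 - 4 * k) / u + (w\<^sup>2 - 4 * k) / w) =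
        (u - w)\<^sup>2 * (1 + 4 * k / (u * w)) / (u + w)"
      using uw_pos by (simp add: divide_simps) (simp add: algebra_simps power2_eq_square)
    also have "\<dots> \<ge> 0"
      using nonneg by simp
    finally show ?thesis by simp
  qed
  then show ?thesis
    unfolding rhs x y unfolding u_def[symmetric] w_def[symmetric] .
qed

text \<open>
  Swapping the two hypotheses in the first factor turns the summand into its average with the
  swapped summand, for which the termwise bound holds.
\<close>

lemma chi_sq_pair:
  fixes p q :: "'a \<Rightarrow> real" and p' q' :: "'b \<Rightarrow> real"
  assumes nn: "\<And>x. 0 \<le> p x" "\<And>x. 0 \<le> q x" "\<And>y. 0 \<le> p' y" "\<And>y. 0 \<le> q' y"
    and one: "sum p \<Omega> = 1" "sum q \<Omega> = 1" "sum p' \<Omega>' = 1" "sum q' \<Omega>' = 1"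
    and swap: "\<And>F :: real \<Rightarrow> real \<Rightarrow> real. (\<Sum>x\<in>\<Omega>. F (p x) (q x)) = (\<Sum>x\<in>\<Omega>. F (q x) (p x))"
  shows "(\<Sum>x\<in>\<Omega>. \<Sum>y\<in>\<Omega>'. (p x * p' y - q x * q' y)\<^sup>2 / (p x * p' y + q x * q' y)) / 2 \<le>
    chi_sq \<Omega> p q + chi_sq \<Omega>' p' q'"
proof -
  define f where "f a b = (\<Sum>y\<in>\<Omega>'. (a * p' y - b * q' y)\<^sup>2 / (a * p' y + b * q' y))" for a b
  have "2 * (\<Sum>x\<in>\<Omega>. f (p x) (q x)) = (\<Sum>x\<in>\<Omega>. f (p x) (q x)) + (\<Sum>x\<in>\<Omega>. f (q x) (p x))"
    using swap[of f] by simp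
  also have "\<dots> = (\<Sum>x\<in>\<Omega>. \<Sum>y\<in>\<Omega>'. (p x * p' y - q x * q' y)\<^sup>2 / (p x * p' y + q x * q' y) +
      (q x * p' y - p x * q' y)\<^sup>2 / (q x * p' y + p x * q' y))"
    by (simp add: f_def sum.distrib)
  also have "\<dots> \<le> (\<Sum>x\<in>\<Omega>. \<Sum>y\<in>\<Omega>'. (p x - q x)\<^sup>2 / (p x + q x) * (p' y + q' y) +
      (p' y - q' y)\<^sup>2 / (p' y + q' y) * (p x + q x))"
    by (intro sum_mono chi_sq_term_symmetrized nn)
  also have "\<dots> = (\<Sum>x\<in>\<Omega>. (p x - q x)\<^sup>2 / (p x + q x)) * (\<Sum>y\<in>\<Omega>'. p' y + q' y) +
      (\<Sum>y\<in>\<Omega>'. (p' y - q' y)\<^sup>2 / (p' y + q' y)) * (\<Sum>x\<in>\<Omega>. p x + q x)"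
    unfolding sum.distrib[where g = "\<lambda>y. _ y * (p _ + q _)"] sum_product
    by (simp only: sum.distrib) (subst (2) sum.swap, simp)
  also have "\<dots> = 4 * (chi_sq \<Omega> p q + chi_sq \<Omega>' p' q')"
    using one by (simp add: sum.distrib chi_sq_def)
  finally show ?thesis
    by (simp add: f_def)
qed

lemma sum_PiE_insert:
  assumes "i \<notin> I"
  shows "(\<Sum>g\<in>PiE (insert i I) T. F g) = (\<Sum>y\<in>T i. \<Sum>g\<in>PiE I T. F (g(i := y)))"
  unfolding PiE_insert_eq
  by (subst sum.reindex[OF inj_combinator[OF assms]])
    (simp add: sum.cartesian_product case_prod_unfold)

text \<open>Coordinates are split off one at a time. The split coordinate is put first in
  \<open>chi_sq_pair\<close>, so the swap symmetry is needed only for single coordinates and not for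
  the remaining product.\<close>

lemma chi_sq_PiE:
  fixes p q :: "'i \<Rightarrow> 'a \<Rightarrow> real"
  assumes "finite I" "finite \<Omega>"
    and nn: "\<And>i x. 0 \<le> p i x" "\<And>i x. 0 \<le> q i x"
    and one: "\<And>i. sum (p i) \<Omega> = 1" "\<And>i. sum (q i) \<Omega> = 1"
    and swap: "\<And>i (F :: real \<Rightarrow> real \<Rightarrow> real).
      (\<Sum>x\<in>\<Omega>. F (p i x) (q i x)) = (\<Sum>x\<in>\<Omega>. F (q i x) (p i x))"
  shows "chi_sq (I \<rightarrow>\<^sub>E \<Omega>) (\<lambda>g. \<Prod>i\<in>I. p i (g i)) (\<lambda>g. \<Prod>i\<in>I. q i (g i)) \<le>
    (\<Sum>i\<in>I. chi_sq \<Omega> (p i) (q i))"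
  using assms(1)
proof (induction I rule: finite_induct)
  case empty
  then show ?case by (simp add: chi_sq_def)
next
  case (insert j I)
  let ?P = "\<lambda>g. \<Prod>i\<in>I. p i (g i)" and ?Q = "\<lambda>g. \<Prod>i\<in>I. q i (g i)"
  have upd: "(\<Prod>i\<in>insert j I. r i ((g(j := x)) i)) = r j x * (\<Prod>i\<in>I. r i (g i))"
    for r :: "'i \<Rightarrow> 'a \<Rightarrow> real" and g x
    using insert.hyps by (auto intro!: prod.cong)
  have norm: "(\<Sum>g\<in>I \<rightarrow>\<^sub>E \<Omega>. \<Prod>i\<in>I. r i (g i)) = 1" if "\<And>i. sum (r i) \<Omega> = 1"
    for r :: "'i \<Rightarrow> 'a \<Rightarrow> real"
    using prod_sum_PiE[of I "\<lambda>_. \<Omega>" r] insert.hyps assms(2) that by simp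
  have "chi_sq (insert j I \<rightarrow>\<^sub>E \<Omega>) (\<lambda>g. \<Prod>i\<in>insert j I. p i (g i)) (\<lambda>g. \<Prod>i\<in>insert j I. q i (g i)) =
      (\<Sum>x\<in>\<Omega>. \<Sum>g\<in>I \<rightarrow>\<^sub>E \<Omega>. (p j x * ?P g - q j x * ?Q g)\<^sup>2 / (p j x * ?P g + q j x * ?Q g)) / 2"
    unfolding chi_sq_def sum_PiE_insert[OF insert.hyps(2)] upd ..
  also have "\<dots> \<le> chi_sq \<Omega> (p j) (q j) + chi_sq (I \<rightarrow>\<^sub>E \<Omega>) ?P ?Q"
    by (intro chi_sq_pair nn prod_nonneg ballI one norm swap)
  also have "\<dots> \<le> chi_sq \<Omega> (p j) (q j) + (\<Sum>i\<in>I. chi_sq \<Omega> (p i) (q i))"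
    using insert.IH by simp
  finally show ?case
    using insert.hyps by simp
qed

text \<open>The sum over the leaves of the product of \<open>t\<close> along the path to the root;
  at \<theta> squared it is the quantity \<open>A\<close> of the overview.\<close>

primrec path_sum :: "nat \<Rightarrow> nat \<Rightarrow> (nat list \<Rightarrow> real) \<Rightarrow> real" where
  "path_sum \<Delta> 0 t = 1"
| "path_sum \<Delta> (Suc h) t = (\<Sum>i<\<Delta>. t [i] * path_sum \<Delta> h (subtree i t))"

lemma branch_prob_1:
  "branch_prob \<Delta> h \<theta> i 1 \<tau> =
    ((1 - \<theta> [i]) / 2) * leaf_prob \<Delta> h (subtree i \<theta>) (-1) \<tau> +
    ((1 + \<theta> [i]) / 2) * leaf_prob \<Delta> h (subtree i \<theta>) 1 \<tau>"
  by (simp add: branch_prob_def edge_kernel_def)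

lemma branch_prob_minus_1:
  "branch_prob \<Delta> h \<theta> i (-1) \<tau> =
    ((1 + \<theta> [i]) / 2) * leaf_prob \<Delta> h (subtree i \<theta>) (-1) \<tau> +
    ((1 - \<theta> [i]) / 2) * leaf_prob \<Delta> h (subtree i \<theta>) 1 \<tau>"
  by (simp add: branch_prob_def edge_kernel_def)

definition leaf_chi_sq :: "nat \<Rightarrow> nat \<Rightarrow> (nat list \<Rightarrow> real) \<Rightarrow> real" where
  "leaf_chi_sq \<Delta> h \<theta> =
    chi_sq (spin_configs (tree_leaves \<Delta> h)) (leaf_prob \<Delta> h \<theta> 1) (leaf_prob \<Delta> h \<theta> (-1))"

text \<open>The channel preserves the sum of the two laws and multiplies their difference by
  \<theta>, so only the numerators change.\<close>

lemma chi_sq_branch_prob: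
  "chi_sq (spin_configs (tree_leaves \<Delta> h)) (branch_prob \<Delta> h \<theta> i 1) (branch_prob \<Delta> h \<theta> i (-1)) =
    (\<theta> [i])\<^sup>2 * leaf_chi_sq \<Delta> h (subtree i \<theta>)"
proof -
  have "branch_prob \<Delta> h \<theta> i 1 \<tau> + branch_prob \<Delta> h \<theta> i (-1) \<tau> =
      leaf_prob \<Delta> h (subtree i \<theta>) 1 \<tau> + leaf_prob \<Delta> h (subtree i \<theta>) (-1) \<tau>" for \<tau>
    unfolding branch_prob_1 branch_prob_minus_1 by (simp add: field_simps)
  moreover have "branch_prob \<Delta> h \<theta> i 1 \<tau> - branch_prob \<Delta> h \<theta> i (-1) \<tau> =
      \<theta> [i] * (leaf_prob \<Delta> h (subtree i \<theta>) 1 \<tau> - leaf_prob \<Delta> h (subtree i \<theta>) (-1) \<tau>)" for \<tau>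
    unfolding branch_prob_1 branch_prob_minus_1 by (simp add: field_simps)
  ultimately show ?thesis
    by (simp add: leaf_chi_sq_def chi_sq_def power_mult_distrib sum_distrib_left)
qed

text \<open>At height 0 the laws are two distinct point masses, at distance 1. Each further level
  combines subadditivity over the children with the contraction along their edges, in the recursion
  of \<open>path_sum\<close>.\<close>

lemma leaf_chi_sq_le_path_sum:
  "(\<And>v. \<bar>\<theta> v\<bar> \<le> 1) \<Longrightarrow> leaf_chi_sq \<Delta> h \<theta> \<le> path_sum \<Delta> h (\<lambda>v. (\<theta> v)\<^sup>2)"
proof (induction h arbitrary: \<theta>)
  case 0
  show ?case
    unfolding leaf_chi_sq_def chi_sq_def leaf_prob.simps tree_leaves_0
    using sum_spin_configs_Nil[of "\<lambda>x. (of_bool (x = 1) - of_bool (x = -1))\<^sup>2 /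
      (of_bool (x = 1) + of_bool (x = -1)) :: real"] by simp
next
  case (Suc h)
  let ?\<Omega> = "spin_configs (tree_leaves \<Delta> h)"
  define H where "H a b = (a - b)\<^sup>2 / (a + b)" for a b :: real
  have swap: "(\<Sum>\<tau>\<in>?\<Omega>. F (branch_prob \<Delta> h \<theta> i 1 \<tau>) (branch_prob \<Delta> h \<theta> i (-1) \<tau>)) =
      (\<Sum>\<tau>\<in>?\<Omega>. F (branch_prob \<Delta> h \<theta> i (-1) \<tau>) (branch_prob \<Delta> h \<theta> i 1 \<tau>))"
    for i and F :: "real \<Rightarrow> real \<Rightarrow> real"
    unfolding branch_prob_1 branch_prob_minus_1
    using sum_leaf_prob_flip[of "\<lambda>a b. F ((1 - \<theta> [i]) / 2 * b + (1 + \<theta> [i]) / 2 * a)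
      ((1 + \<theta> [i]) / 2 * b + (1 - \<theta> [i]) / 2 * a)" \<Delta> h "subtree i \<theta>"]
    by (simp add: add.commute)
  have "leaf_chi_sq \<Delta> (Suc h) \<theta> =
      chi_sq ({..<\<Delta>} \<rightarrow>\<^sub>E ?\<Omega>) (\<lambda>g. \<Prod>i<\<Delta>. branch_prob \<Delta> h \<theta> i 1 (g i))
        (\<lambda>g. \<Prod>i<\<Delta>. branch_prob \<Delta> h \<theta> i (-1) (g i))"
    unfolding leaf_chi_sq_def chi_sq_def leaf_prob_Suc_branch H_def[symmetric]
    using sum_leaf_configs_Suc[where \<Delta> = \<Delta> and h = h and
      F = "\<lambda>g. H (\<Prod>i<\<Delta>. branch_prob \<Delta> h \<theta> i 1 (g i)) (\<Prod>i<\<Delta>. branch_prob \<Delta> h \<theta> i (-1) (g i))"]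
    by simp
  also have "\<dots> \<le> (\<Sum>i<\<Delta>. chi_sq ?\<Omega> (branch_prob \<Delta> h \<theta> i 1) (branch_prob \<Delta> h \<theta> i (-1)))"
    using Suc.prems
    by (intro chi_sq_PiE branch_prob_nonneg sum_branch_prob_1 swap finite_spin_configs
        finite_tree_leaves) auto
  also have "\<dots> \<le> (\<Sum>i<\<Delta>. (\<theta> [i])\<^sup>2 * path_sum \<Delta> h (\<lambda>v. (subtree i \<theta> v)\<^sup>2))"
    unfolding chi_sq_branch_prob using Suc.prems
    by (intro sum_mono mult_left_mono Suc.IH) (auto simp: subtree_def)
  finally show ?case
    by (simp add: subtree_def)
qed

text \<open>A linearized Cauchy--Schwarz bound: the free parameter \<open>c\<close> replaces a
  square root, so the expectation can be taken before \<open>c\<close> is chosen.\<close>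

lemma leaf_tv_le:
  assumes \<theta>: "\<And>v. \<bar>\<theta> v\<bar> \<le> 1" and c: "c > 0"
  shows "leaf_tv \<Delta> h \<theta> \<le> c / 2 + path_sum \<Delta> h (\<lambda>v. (\<theta> v)\<^sup>2) / (2 * c)"
proof -
  let ?\<Omega> = "spin_configs (tree_leaves \<Delta> h)"
  let ?p = "leaf_prob \<Delta> h \<theta> 1" and ?q = "leaf_prob \<Delta> h \<theta> (-1)"
  \<comment> \<open>Expand the square of \<open>c * (a + b) - \<bar>a - b\<bar>\<close> and divide
    by \<open>2 * c * (a + b)\<close>.\<close>
  have am_gm: "\<bar>a - b\<bar> \<le> c / 2 * (a + b) + 1 / (2 * c) * ((a - b)\<^sup>2 / (a + b))"
    if "a \<ge> 0" "b \<ge> 0" for a b :: real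
  proof (cases "a + b = 0")
    case True
    with that show ?thesis by (simp add: add_nonneg_eq_0_iff)
  next
    case False
    with that have ab: "a + b > 0" by simp
    have "0 \<le> (c * (a + b) - \<bar>a - b\<bar>)\<^sup>2 / (2 * c * (a + b))"
      using ab c by simp
    also have "\<dots> = (c\<^sup>2 * (a + b)\<^sup>2 - 2 * c * (a + b) * \<bar>a - b\<bar> + (a - b)\<^sup>2) / (2 * c * (a + b))"
      unfolding power2_diff[of "c * (a + b)"] by (simp add: power_mult_distrib)
    also have "\<dots> = c / 2 * (a + b) + 1 / (2 * c) * ((a - b)\<^sup>2 / (a + b)) - \<bar>a - b\<bar>"
      using ab c by (simp add: divide_simps) (simp add: power2_eq_square algebra_simps)
    finally show ?thesis by simp
  qed
  have "leaf_tv \<Delta> h \<theta> \<le> (\<Sum>\<tau>\<in>?\<Omega>. c / 2 * (?p \<tau> + ?q \<tau>) +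
      1 / (2 * c) * ((?p \<tau> - ?q \<tau>)\<^sup>2 / (?p \<tau> + ?q \<tau>))) / 2"
    unfolding leaf_tv_def
    by (intro divide_right_mono sum_mono am_gm leaf_prob_nonneg \<theta>) auto
  also have "\<dots> = (c / 2 * ((\<Sum>\<tau>\<in>?\<Omega>. ?p \<tau>) + (\<Sum>\<tau>\<in>?\<Omega>. ?q \<tau>)) + 1 / (2 * c) * (2 * leaf_chi_sq \<Delta> h \<theta>)) / 2"
    by (simp only: leaf_chi_sq_def chi_sq_def sum.distrib flip: sum_distrib_left) simp
  also have "\<dots> = c / 2 + leaf_chi_sq \<Delta> h \<theta> / (2 * c)"
    by (simp add: sum_leaf_prob field_simps)
  also have "\<dots> \<le> c / 2 + path_sum \<Delta> h (\<lambda>v. (\<theta> v)\<^sup>2) / (2 * c)"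
    using leaf_chi_sq_le_path_sum[OF \<theta>] c by (simp add: divide_right_mono)
  finally show ?thesis .
qed

section \<open>The weighted leaf statistic\<close>

primrec leaf_stat ::
  "nat \<Rightarrow> nat \<Rightarrow> (nat list \<Rightarrow> real) \<Rightarrow> (nat list \<Rightarrow> int) \<Rightarrow> real" where
  "leaf_stat \<Delta> 0 \<theta> \<tau> = of_int (\<tau> [])"
| "leaf_stat \<Delta> (Suc h) \<theta> \<tau> =
    (\<Sum>i<\<Delta>. \<theta> [i] * leaf_stat \<Delta> h (subtree i \<theta>) (subtree i \<tau>))"

text \<open>The sum over ordered pairs of leaves of the product of \<open>t\<close> over the union
  of their two paths, with shared edges counted once. This is the second moment \<open>B\<close> of
  the overview: a shared edge gets \<theta> from both weights, any other edge one \<theta> from its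
  weight and one from the correlation of the spins.\<close>

primrec pair_sum :: "nat \<Rightarrow> nat \<Rightarrow> (nat list \<Rightarrow> real) \<Rightarrow> real" where
  "pair_sum \<Delta> 0 t = 1"
| "pair_sum \<Delta> (Suc h) t = (\<Sum>i<\<Delta>. t [i] * pair_sum \<Delta> h (subtree i t) +
    (\<Sum>j\<in>{..<\<Delta>} - {i}. (t [i] * path_sum \<Delta> h (subtree i t)) * (t [j] * path_sum \<Delta> h (subtree j t))))"

lemma leaf_stat_cong:
  "(\<And>v. v \<in> tree_leaves \<Delta> h \<Longrightarrow> \<tau> v = \<tau>' v) \<Longrightarrow> leaf_stat \<Delta> h \<theta> \<tau> = leaf_stat \<Delta> h \<theta> \<tau>'"
proof (induction h arbitrary: \<theta> \<tau> \<tau>')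
  case 0
  then show ?case by (simp add: tree_leaves_0)
next
  case (Suc h)
  have "leaf_stat \<Delta> h \<theta>' (subtree i \<tau>) = leaf_stat \<Delta> h \<theta>' (subtree i \<tau>')"
    if "i < \<Delta>" for i \<theta>'
    using Suc.prems that
    by (intro Suc.IH) (auto simp: subtree_def tree_leaves_Suc Cons_in_graft)
  then show ?case by simp
qed

lemma leaf_stat_Suc_restrict:
  "leaf_stat \<Delta> (Suc h) \<theta> \<tau> =
    (\<Sum>i<\<Delta>. \<theta> [i] * leaf_stat \<Delta> h (subtree i \<theta>) (restrict (subtree i \<tau>) (tree_leaves \<Delta> h)))"
proof -
  have "leaf_stat \<Delta> h \<theta>' (restrict (subtree i \<tau>) (tree_leaves \<Delta> h)) =
      leaf_stat \<Delta> h \<theta>' (subtree i \<tau>)" for \<theta>' i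
    by (rule leaf_stat_cong) simp
  then show ?thesis by simp
qed

lemma sum_leaf_prob_Suc:
  "(\<Sum>\<tau>\<in>spin_configs (tree_leaves \<Delta> (Suc h)).
      leaf_prob \<Delta> (Suc h) \<theta> s \<tau> * F (leaf_stat \<Delta> (Suc h) \<theta> \<tau>)) =
    (\<Sum>g\<in>{..<\<Delta>} \<rightarrow>\<^sub>E spin_configs (tree_leaves \<Delta> h).
      (\<Prod>i<\<Delta>. branch_prob \<Delta> h \<theta> i s (g i)) *
      F (\<Sum>i<\<Delta>. \<theta> [i] * leaf_stat \<Delta> h (subtree i \<theta>) (g i)))"
  unfolding leaf_prob_Suc_branch leaf_stat_Suc_restrict
  using sum_leaf_configs_Suc[where \<Delta> = \<Delta> and h = h and
    F = "\<lambda>g. (\<Prod>i<\<Delta>. branch_prob \<Delta> h \<theta> i s (g i)) *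
      F (\<Sum>i<\<Delta>. \<theta> [i] * leaf_stat \<Delta> h (subtree i \<theta>) (g i))"]
  by simp

section \<open>Expectations under product weights\<close>

lemma sum_PiE_prod_weight:
  fixes p f :: "'i \<Rightarrow> 'a \<Rightarrow> real"
  assumes "finite I" "finite \<Omega>"
  shows "(\<Sum>g\<in>I \<rightarrow>\<^sub>E \<Omega>. (\<Prod>i\<in>I. p i (g i)) * (\<Prod>i\<in>I. f i (g i))) =
    (\<Prod>i\<in>I. \<Sum>x\<in>\<Omega>. p i x * f i x)"
  using assms by (subst prod_sum_PiE) (simp_all add: prod.distrib)

lemma sum_PiE_coordinate:
  fixes p :: "'i \<Rightarrow> 'a \<Rightarrow> real"
  assumes "finite I" "finite \<Omega>" "j \<in> I" and one: "\<And>i. sum (p i) \<Omega> = 1"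
  shows "(\<Sum>g\<in>I \<rightarrow>\<^sub>E \<Omega>. (\<Prod>i\<in>I. p i (g i)) * f (g j)) = (\<Sum>x\<in>\<Omega>. p j x * f x)"
proof -
  have "(\<Sum>g\<in>I \<rightarrow>\<^sub>E \<Omega>. (\<Prod>i\<in>I. p i (g i)) * f (g j)) =
      (\<Sum>g\<in>I \<rightarrow>\<^sub>E \<Omega>. (\<Prod>i\<in>I. p i (g i)) * (\<Prod>i\<in>I. (if i = j then f else (\<lambda>_. 1)) (g i)))"
    using assms by (simp add: if_distribR prod.delta)
  also have "\<dots> = (\<Prod>i\<in>I. \<Sum>x\<in>\<Omega>. p i x * (if i = j then f else (\<lambda>_. 1)) x)"
    using assms(1,2) by (rule sum_PiE_prod_weight)
  also have "\<dots> = (\<Prod>i\<in>I. if i = j then \<Sum>x\<in>\<Omega>. p j x * f x else 1)"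
    by (intro prod.cong refl) (simp add: one)
  finally show ?thesis
    using assms by (simp add: prod.delta)
qed

lemma sum_PiE_coordinate_pair:
  fixes p :: "'i \<Rightarrow> 'a \<Rightarrow> real"
  assumes "finite I" "finite \<Omega>" "j \<in> I" "k \<in> I" "j \<noteq> k" and one: "\<And>i. sum (p i) \<Omega> = 1"
  shows "(\<Sum>g\<in>I \<rightarrow>\<^sub>E \<Omega>. (\<Prod>i\<in>I. p i (g i)) * (f (g j) * f' (g k))) =
    (\<Sum>x\<in>\<Omega>. p j x * f x) * (\<Sum>x\<in>\<Omega>. p k x * f' x)"
proof -
  define F where "F i = (if i = j then f else if i = k then f' else (\<lambda>_. 1))" for i
  have split: "(\<Prod>i\<in>I. a i) = a j * a k" if "\<And>i. i \<in> I - {j, k} \<Longrightarrow> a i = 1" for a :: "'i \<Rightarrow> real"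
  proof -
    have "(\<Prod>i\<in>I. a i) = (\<Prod>i\<in>{j, k}. a i)"
      using assms that by (intro prod.mono_neutral_right) auto
    then show ?thesis using assms(5) by simp
  qed
  have "(\<Sum>g\<in>I \<rightarrow>\<^sub>E \<Omega>. (\<Prod>i\<in>I. p i (g i)) * (f (g j) * f' (g k))) =
      (\<Sum>g\<in>I \<rightarrow>\<^sub>E \<Omega>. (\<Prod>i\<in>I. p i (g i)) * (\<Prod>i\<in>I. F i (g i)))"
    using assms(5) by (subst split[where a = "\<lambda>i. F i (_ i)"]) (auto simp: F_def)
  also have "\<dots> = (\<Prod>i\<in>I. \<Sum>x\<in>\<Omega>. p i x * F i x)"
    using assms(1,2) by (rule sum_PiE_prod_weight)
  also have "\<dots> = (\<Sum>x\<in>\<Omega>. p j x * F j x) * (\<Sum>x\<in>\<Omega>. p k x * F k x)"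
    by (intro split) (auto simp: F_def one)
  finally show ?thesis
    using assms(5) by (simp add: F_def)
qed

lemma sum_edge_kernel_spin:
  "(\<Sum>s'\<in>{-1, 1}. edge_kernel \<theta> s s' * (of_int s' * a)) = of_int s * \<theta> * a"
  by (simp add: edge_kernel_def field_simps)

text \<open>Every edge enters once through the channel and once through the weight of the statistic,
  which turns \<theta> into its square.\<close>

lemma leaf_stat_mean:
  "s \<in> {-1, 1} \<Longrightarrow>
    (\<Sum>\<tau>\<in>spin_configs (tree_leaves \<Delta> h). leaf_prob \<Delta> h \<theta> s \<tau> * leaf_stat \<Delta> h \<theta> \<tau>) =
    of_int s * path_sum \<Delta> h (\<lambda>v. (\<theta> v)\<^sup>2)"
proof (induction h arbitrary: s \<theta>)
  case 0
  then show ?case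
    using sum_spin_configs_Nil[of "\<lambda>x. of_bool (x = s) * real_of_int x"]
    by (auto simp: tree_leaves_0)
next
  case (Suc h)
  let ?\<Omega> = "spin_configs (tree_leaves \<Delta> h)"
  have fin: "finite ?\<Omega>"
    by (intro finite_spin_configs finite_tree_leaves)
  have br: "(\<Sum>\<tau>\<in>?\<Omega>. branch_prob \<Delta> h \<theta> i s \<tau> * leaf_stat \<Delta> h (subtree i \<theta>) \<tau>) =
      of_int s * \<theta> [i] * path_sum \<Delta> h (\<lambda>v. (subtree i \<theta> v)\<^sup>2)" for i
    by (subst sum_branch_prob[OF Suc.IH]) (assumption, rule sum_edge_kernel_spin)
  have "(\<Sum>\<tau>\<in>spin_configs (tree_leaves \<Delta> (Suc h)).
      leaf_prob \<Delta> (Suc h) \<theta> s \<tau> * leaf_stat \<Delta> (Suc h) \<theta> \<tau>) =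
    (\<Sum>g\<in>{..<\<Delta>} \<rightarrow>\<^sub>E ?\<Omega>. (\<Prod>i<\<Delta>. branch_prob \<Delta> h \<theta> i s (g i)) *
      (\<Sum>j<\<Delta>. \<theta> [j] * leaf_stat \<Delta> h (subtree j \<theta>) (g j)))"
    by (rule sum_leaf_prob_Suc)
  also have "\<dots> = (\<Sum>j<\<Delta>. \<Sum>g\<in>{..<\<Delta>} \<rightarrow>\<^sub>E ?\<Omega>. (\<Prod>i<\<Delta>. branch_prob \<Delta> h \<theta> i s (g i)) *
      (\<theta> [j] * leaf_stat \<Delta> h (subtree j \<theta>) (g j)))"
    unfolding sum_distrib_left by (rule sum.swap)
  also have "\<dots> = (\<Sum>j<\<Delta>. \<Sum>\<tau>\<in>?\<Omega>. branch_prob \<Delta> h \<theta> j s \<tau> * (\<theta> [j] * leaf_stat \<Delta> h (subtree j \<theta>) \<tau>))"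
    using fin Suc.prems by (intro sum.cong refl sum_PiE_coordinate sum_branch_prob_1) auto
  also have "\<dots> = (\<Sum>j<\<Delta>. \<theta> [j] * (\<Sum>\<tau>\<in>?\<Omega>. branch_prob \<Delta> h \<theta> j s \<tau> * leaf_stat \<Delta> h (subtree j \<theta>) \<tau>))"
    by (simp add: sum_distrib_left mult.left_commute)
  also have "\<dots> = of_int s * path_sum \<Delta> (Suc h) (\<lambda>v. (\<theta> v)\<^sup>2)"
    unfolding br by (simp add: sum_distrib_left subtree_def power2_eq_square mult.assoc mult.left_commute)
  finally show ?case .
qed

text \<open>In the expanded square, the diagonal terms follow from the induction hypothesis, whose
  value is the same for both child spins. Distinct children are independent given the root, so the
  other terms are products of two means, and the sign \<open>s\<close> enters squared.\<close>

lemma leaf_stat_second_moment: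
  "s \<in> {-1, 1} \<Longrightarrow>
    (\<Sum>\<tau>\<in>spin_configs (tree_leaves \<Delta> h). leaf_prob \<Delta> h \<theta> s \<tau> * (leaf_stat \<Delta> h \<theta> \<tau>)\<^sup>2) =
    pair_sum \<Delta> h (\<lambda>v. (\<theta> v)\<^sup>2)"
proof (induction h arbitrary: s \<theta>)
  case 0
  then show ?case
    using sum_spin_configs_Nil[of "\<lambda>x. of_bool (x = s) * (real_of_int x)\<^sup>2"]
    by (auto simp: tree_leaves_0)
next
  case (Suc h)
  let ?\<Omega> = "spin_configs (tree_leaves \<Delta> h)"
  let ?p = "\<lambda>i. branch_prob \<Delta> h \<theta> i s" and ?S = "\<lambda>i. leaf_stat \<Delta> h (subtree i \<theta>)"
  let ?t = "\<lambda>v. (\<theta> v)\<^sup>2"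
  have fin: "finite ?\<Omega>"
    by (intro finite_spin_configs finite_tree_leaves)
  have ss: "real_of_int s * real_of_int s = 1"
    using Suc.prems by auto
  have sub: "(\<lambda>v. (subtree i \<theta> v)\<^sup>2) = subtree i ?t" for i
    by (simp add: subtree_def)
  have br1: "(\<Sum>\<tau>\<in>?\<Omega>. ?p i \<tau> * (\<theta> [i] * ?S i \<tau>)) =
      of_int s * (?t [i] * path_sum \<Delta> h (subtree i ?t))" for i
  proof -
    have "(\<Sum>\<tau>\<in>?\<Omega>. ?p i \<tau> * (\<theta> [i] * ?S i \<tau>)) = \<theta> [i] * (\<Sum>\<tau>\<in>?\<Omega>. ?p i \<tau> * ?S i \<tau>)"
      by (simp add: sum_distrib_left mult.left_commute)
    also have "(\<Sum>\<tau>\<in>?\<Omega>. ?p i \<tau> * ?S i \<tau>) = of_int s * \<theta> [i] * path_sum \<Delta> h (subtree i ?t)"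
      unfolding sub[symmetric]
      by (subst sum_branch_prob[OF leaf_stat_mean]) (assumption, rule sum_edge_kernel_spin)
    finally show ?thesis
      by (simp add: power2_eq_square)
  qed
  have br2: "(\<Sum>\<tau>\<in>?\<Omega>. ?p i \<tau> * (\<theta> [i] * ?S i \<tau>)\<^sup>2) = ?t [i] * pair_sum \<Delta> h (subtree i ?t)" for i
  proof -
    have "(\<Sum>\<tau>\<in>?\<Omega>. ?p i \<tau> * (\<theta> [i] * ?S i \<tau>)\<^sup>2) = ?t [i] * (\<Sum>\<tau>\<in>?\<Omega>. ?p i \<tau> * (?S i \<tau>)\<^sup>2)"
      by (simp add: sum_distrib_left power_mult_distrib mult.left_commute)
    also have "(\<Sum>\<tau>\<in>?\<Omega>. ?p i \<tau> * (?S i \<tau>)\<^sup>2) = pair_sum \<Delta> h (subtree i ?t)"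
      unfolding sub[symmetric]
      by (subst sum_branch_prob[OF Suc.IH])
        (assumption, simp only: sum_distrib_right[symmetric] sum_edge_kernel mult_1_left)
    finally show ?thesis .
  qed
  have "(\<Sum>\<tau>\<in>spin_configs (tree_leaves \<Delta> (Suc h)).
      leaf_prob \<Delta> (Suc h) \<theta> s \<tau> * (leaf_stat \<Delta> (Suc h) \<theta> \<tau>)\<^sup>2) =
    (\<Sum>g\<in>{..<\<Delta>} \<rightarrow>\<^sub>E ?\<Omega>. (\<Prod>i<\<Delta>. ?p i (g i)) * (\<Sum>j<\<Delta>. \<theta> [j] * ?S j (g j))\<^sup>2)"
    by (rule sum_leaf_prob_Suc)
  also have "\<dots> = (\<Sum>g\<in>{..<\<Delta>} \<rightarrow>\<^sub>E ?\<Omega>. \<Sum>j<\<Delta>. \<Sum>k<\<Delta>. (\<Prod>i<\<Delta>. ?p i (g i)) *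
      ((\<theta> [j] * ?S j (g j)) * (\<theta> [k] * ?S k (g k))))"
    unfolding power2_eq_square sum_product by (simp only: sum_distrib_left)
  also have "\<dots> = (\<Sum>j<\<Delta>. \<Sum>g\<in>{..<\<Delta>} \<rightarrow>\<^sub>E ?\<Omega>. \<Sum>k<\<Delta>. (\<Prod>i<\<Delta>. ?p i (g i)) *
      ((\<theta> [j] * ?S j (g j)) * (\<theta> [k] * ?S k (g k))))"
    by (rule sum.swap)
  also have "\<dots> = (\<Sum>j<\<Delta>. \<Sum>k<\<Delta>. \<Sum>g\<in>{..<\<Delta>} \<rightarrow>\<^sub>E ?\<Omega>. (\<Prod>i<\<Delta>. ?p i (g i)) *
      ((\<theta> [j] * ?S j (g j)) * (\<theta> [k] * ?S k (g k))))"
    by (intro sum.cong refl sum.swap)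
  also have "\<dots> = pair_sum \<Delta> (Suc h) ?t"
    unfolding pair_sum.simps
  proof (rule sum.cong[OF refl])
    fix j assume j: "j \<in> {..<\<Delta>}"
    have diag: "(\<Sum>g\<in>{..<\<Delta>} \<rightarrow>\<^sub>E ?\<Omega>. (\<Prod>i<\<Delta>. ?p i (g i)) *
        ((\<theta> [j] * ?S j (g j)) * (\<theta> [j] * ?S j (g j)))) = ?t [j] * pair_sum \<Delta> h (subtree j ?t)"
      unfolding power2_eq_square[symmetric] br2[symmetric]
      using fin j Suc.prems by (intro sum_PiE_coordinate sum_branch_prob_1) auto
    have off: "(\<Sum>g\<in>{..<\<Delta>} \<rightarrow>\<^sub>E ?\<Omega>. (\<Prod>i<\<Delta>. ?p i (g i)) *
        ((\<theta> [j] * ?S j (g j)) * (\<theta> [k] * ?S k (g k)))) =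
        (?t [j] * path_sum \<Delta> h (subtree j ?t)) * (?t [k] * path_sum \<Delta> h (subtree k ?t))"
      if "k \<in> {..<\<Delta>} - {j}" for k
    proof -
      have "(\<Sum>g\<in>{..<\<Delta>} \<rightarrow>\<^sub>E ?\<Omega>. (\<Prod>i<\<Delta>. ?p i (g i)) *
        ((\<theta> [j] * ?S j (g j)) * (\<theta> [k] * ?S k (g k)))) =
        (\<Sum>\<tau>\<in>?\<Omega>. ?p j \<tau> * (\<theta> [j] * ?S j \<tau>)) * (\<Sum>\<tau>\<in>?\<Omega>. ?p k \<tau> * (\<theta> [k] * ?S k \<tau>))"
        using fin j that Suc.prems by (intro sum_PiE_coordinate_pair sum_branch_prob_1) auto
      also have "\<dots> = (real_of_int s * real_of_int s) *
          ((?t [j] * path_sum \<Delta> h (subtree j ?t)) * (?t [k] * path_sum \<Delta> h (subtree k ?t)))"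
        unfolding br1 by (simp only: mult_ac)
      finally show ?thesis
        by (simp only: ss mult_1_left)
    qed
    show "(\<Sum>k<\<Delta>. \<Sum>g\<in>{..<\<Delta>} \<rightarrow>\<^sub>E ?\<Omega>. (\<Prod>i<\<Delta>. ?p i (g i)) *
        ((\<theta> [j] * ?S j (g j)) * (\<theta> [k] * ?S k (g k)))) =
      ?t [j] * pair_sum \<Delta> h (subtree j ?t) +
      (\<Sum>k\<in>{..<\<Delta>} - {j}. (?t [j] * path_sum \<Delta> h (subtree j ?t)) * (?t [k] * path_sum \<Delta> h (subtree k ?t)))"
      by (subst sum.remove[OF finite_lessThan j], subst diag, rule arg_cong2[where f = "(+)", OF refl],
          rule sum.cong[OF refl off])
  qed
  finally show ?case .
qed

text \<open>
  Testing the leaves with the statistic gives \<open>A\<^sup>2 / B\<close> by Cauchy--Schwarz, where \<open>A\<close> and \<open>B\<close> are its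
  mean and second moment. The parameter \<open>c\<close> linearizes this ratio, so that both moments can be
  averaged over the couplings separately.
\<close>

lemma leaf_tv_ge:
  assumes \<theta>: "\<And>v. \<bar>\<theta> v\<bar> \<le> 1"
  shows "2 * c * path_sum \<Delta> h (\<lambda>v. (\<theta> v)\<^sup>2) - c\<^sup>2 * pair_sum \<Delta> h (\<lambda>v. (\<theta> v)\<^sup>2) \<le> leaf_tv \<Delta> h \<theta>"
proof -
  let ?\<Omega> = "spin_configs (tree_leaves \<Delta> h)"
  let ?p = "leaf_prob \<Delta> h \<theta> 1" and ?q = "leaf_prob \<Delta> h \<theta> (-1)" and ?S = "leaf_stat \<Delta> h \<theta>"
  \<comment> \<open>Combines \<open>2 * \<bar>y\<bar> \<le> 1 + y\<^sup>2\<close> with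
    \<open>\<bar>a - b\<bar> \<le> a + b\<close>; it is applied with \<open>y\<close> the scaled
    statistic.\<close>
  have pointwise: "2 * y * (a - b) - y\<^sup>2 * (a + b) \<le> \<bar>a - b\<bar>"
    if "a \<ge> 0" "b \<ge> 0" for a b y :: real
  proof -
    have "y * (a - b) \<le> \<bar>y\<bar> * \<bar>a - b\<bar>"
      by (metis abs_ge_self abs_mult)
    moreover have "y\<^sup>2 * \<bar>a - b\<bar> \<le> y\<^sup>2 * (a + b)"
      using that by (intro mult_left_mono) auto
    moreover have "0 \<le> (1 - \<bar>y\<bar>)\<^sup>2 * \<bar>a - b\<bar>"
      by simp
    moreover have "(1 - \<bar>y\<bar>)\<^sup>2 * \<bar>a - b\<bar> = \<bar>a - b\<bar> - 2 * (\<bar>y\<bar> * \<bar>a - b\<bar>) + y\<^sup>2 * \<bar>a - b\<bar>"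
      unfolding power2_diff by (simp add: algebra_simps)
    ultimately show ?thesis by simp
  qed
  have "(\<Sum>\<tau>\<in>?\<Omega>. 2 * (c * ?S \<tau>) * (?p \<tau> - ?q \<tau>) - (c * ?S \<tau>)\<^sup>2 * (?p \<tau> + ?q \<tau>)) / 2 \<le> leaf_tv \<Delta> h \<theta>"
    unfolding leaf_tv_def
    by (intro divide_right_mono sum_mono pointwise leaf_prob_nonneg \<theta>) auto
  also have "(\<Sum>\<tau>\<in>?\<Omega>. 2 * (c * ?S \<tau>) * (?p \<tau> - ?q \<tau>) - (c * ?S \<tau>)\<^sup>2 * (?p \<tau> + ?q \<tau>)) =
      (\<Sum>\<tau>\<in>?\<Omega>. 2 * c * (?p \<tau> * ?S \<tau>) - 2 * c * (?q \<tau> * ?S \<tau>) -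
        c\<^sup>2 * (?p \<tau> * (?S \<tau>)\<^sup>2) - c\<^sup>2 * (?q \<tau> * (?S \<tau>)\<^sup>2))"
    by (intro sum.cong refl) (simp add: algebra_simps power_mult_distrib)
  also have "\<dots> = 4 * c * path_sum \<Delta> h (\<lambda>v. (\<theta> v)\<^sup>2) - 2 * c\<^sup>2 * pair_sum \<Delta> h (\<lambda>v. (\<theta> v)\<^sup>2)"
    by (simp only: sum_subtractf sum_distrib_left[symmetric]) (simp add: leaf_stat_mean leaf_stat_second_moment)
  finally show ?thesis by simp
qed

section \<open>Averaging over the couplings\<close>

text \<open>Sums of squarefree monomials in the variables from \<open>S\<close>. Under independence,
  the expectation of such a polynomial is its value at the means.\<close>

inductive multiaffine :: "'v set \<Rightarrow> (('v \<Rightarrow> real) \<Rightarrow> real) \<Rightarrow> bool" for S where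
  zero: "multiaffine S (\<lambda>t. 0)"
| monomial: "finite U \<Longrightarrow> U \<subseteq> S \<Longrightarrow> multiaffine S (\<lambda>t. \<Prod>v\<in>U. t v)"
| add: "multiaffine S f \<Longrightarrow> multiaffine S g \<Longrightarrow> multiaffine S (\<lambda>t. f t + g t)"

lemma multiaffine_mono: "multiaffine S f \<Longrightarrow> S \<subseteq> S' \<Longrightarrow> multiaffine S' f"
  by (induction rule: multiaffine.induct) (auto intro: multiaffine.intros)

lemma multiaffine_one: "multiaffine S (\<lambda>t. 1)"
  using multiaffine.monomial[of "{}" S] by simp

lemma multiaffine_var: "v \<in> S \<Longrightarrow> multiaffine S (\<lambda>t. t v)"
  using multiaffine.monomial[of "{v}" S] by simp

lemma multiaffine_sum:
  "(\<And>i. i \<in> I \<Longrightarrow> multiaffine S (f i)) \<Longrightarrow> multiaffine S (\<lambda>t. \<Sum>i\<in>I. f i t)"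
  by (induction I rule: infinite_finite_induct) (auto intro: multiaffine.intros)

text \<open>Disjoint sets of variables keep the products of monomials squarefree.\<close>

lemma multiaffine_mult:
  assumes "multiaffine S f" "multiaffine S' g" "S \<inter> S' = {}"
  shows "multiaffine (S \<union> S') (\<lambda>t. f t * g t)"
  using assms(1)
proof (induction rule: multiaffine.induct)
  case zero
  then show ?case by (simp add: multiaffine.zero)
next
  case (monomial U)
  show ?case
    using assms(2)
  proof (induction rule: multiaffine.induct)
    case zero
    then show ?case by (simp add: multiaffine.zero)
  next
    case (monomial U')
    have "U \<inter> U' = {}"
      using \<open>U \<subseteq> S\<close> \<open>U' \<subseteq> S'\<close> assms(3) by blast
    then have "(\<lambda>t. (\<Prod>v\<in>U. t v) * (\<Prod>v\<in>U'. t v)) = (\<lambda>t :: 'a \<Rightarrow> real. \<Prod>v\<in>U \<union> U'. t v)"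
      using \<open>finite U\<close> \<open>finite U'\<close> by (simp add: prod.union_disjoint)
    then show ?case
      using \<open>finite U\<close> \<open>finite U'\<close> \<open>U \<subseteq> S\<close> \<open>U' \<subseteq> S'\<close>
      by (auto intro!: multiaffine.monomial)
  next
    case (add f g)
    then show ?case by (simp add: distrib_left multiaffine.add)
  qed
next
  case (add f g)
  then show ?case by (simp add: distrib_right multiaffine.add)
qed

lemma multiaffine_subtree:
  "multiaffine S f \<Longrightarrow> multiaffine ((#) i ` S) (\<lambda>t. f (subtree i t))"
proof (induction rule: multiaffine.induct)
  case zero
  show ?case by (rule multiaffine.zero)
next
  case (monomial U)
  have "multiaffine ((#) i ` S) (\<lambda>t. \<Prod>v\<in>(#) i ` U. t v)"
    using monomial by (intro multiaffine.monomial) auto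
  also have "(\<lambda>t. \<Prod>v\<in>(#) i ` U. t v) = (\<lambda>t. \<Prod>v\<in>U. subtree i t v)"
    by (subst prod.reindex) (auto simp: inj_on_def subtree_def)
  finally show ?case .
next
  case (add f g)
  then show ?case by (intro multiaffine.add)
qed

text \<open>The variable of the edge above child \<open>i\<close> sits at the root of its subtree,
  and the assumption on \<open>f\<close> leaves exactly that vertex out.\<close>

lemma multiaffine_branch:
  assumes "multiaffine (V - {[]}) f" "[] \<in> V"
  shows "multiaffine ((#) i ` V) (\<lambda>t. t [i] * f (subtree i t))"
proof -
  have "multiaffine ({[i]} \<union> (#) i ` (V - {[]})) (\<lambda>t. t [i] * f (subtree i t))"
    using assms(1) by (intro multiaffine_mult multiaffine_var multiaffine_subtree) auto
  then show ?thesis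
    by (rule multiaffine_mono) (use assms(2) in auto)
qed

lemma Cons_image_subset:
  assumes "i < \<Delta>"
  shows "(#) i ` tree_vertices \<Delta> h \<subseteq> tree_vertices \<Delta> (Suc h) - {[]}"
  using assms by (auto simp: tree_vertices_Suc Cons_in_graft)

lemma multiaffine_path_sum: "multiaffine (tree_vertices \<Delta> h - {[]}) (path_sum \<Delta> h)"
proof (induction h)
  case 0
  then show ?case
    using multiaffine_one by (simp add: path_sum_def)
next
  case (Suc h)
  have "path_sum \<Delta> (Suc h) = (\<lambda>t. \<Sum>i<\<Delta>. t [i] * path_sum \<Delta> h (subtree i t))"
    by (simp add: fun_eq_iff)
  moreover have "multiaffine (tree_vertices \<Delta> (Suc h) - {[]}) (\<lambda>t. \<Sum>i<\<Delta>. t [i] * path_sum \<Delta> h (subtree i t))"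
    using Suc
    by (intro multiaffine_sum multiaffine_mono[OF multiaffine_branch Cons_image_subset]
        Nil_in_tree_vertices) auto
  ultimately show ?case by (simp only:)
qed

text \<open>The mixed terms multiply functions of two different subtrees, hence of disjoint sets of
  variables.\<close>

lemma multiaffine_pair_sum: "multiaffine (tree_vertices \<Delta> h - {[]}) (pair_sum \<Delta> h)"
proof (induction h)
  case 0
  then show ?case
    using multiaffine_one by (simp add: pair_sum_def)
next
  case (Suc h)
  let ?S = "tree_vertices \<Delta> (Suc h) - {[]}"
  have branch: "multiaffine ((#) i ` tree_vertices \<Delta> h) (\<lambda>t. t [i] * path_sum \<Delta> h (subtree i t))" for i
    by (rule multiaffine_branch[OF multiaffine_path_sum Nil_in_tree_vertices])
  have diag: "multiaffine ?S (\<lambda>t. t [i] * pair_sum \<Delta> h (subtree i t))" if "i \<in> {..<\<Delta>}" for i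
    using multiaffine_mono[OF multiaffine_branch[OF Suc Nil_in_tree_vertices] Cons_image_subset] that
    by simp
  have off: "multiaffine ?S (\<lambda>t. (t [i] * path_sum \<Delta> h (subtree i t)) * (t [j] * path_sum \<Delta> h (subtree j t)))"
    if "i \<in> {..<\<Delta>}" "j \<in> {..<\<Delta>} - {i}" for i j
  proof (rule multiaffine_mono[OF multiaffine_mult[OF branch branch]])
    show "(#) i ` tree_vertices \<Delta> h \<inter> (#) j ` tree_vertices \<Delta> h = {}"
      using that by auto
    show "(#) i ` tree_vertices \<Delta> h \<union> (#) j ` tree_vertices \<Delta> h \<subseteq> ?S"
      using that by (intro Un_least Cons_image_subset) auto
  qed
  have "pair_sum \<Delta> (Suc h) = (\<lambda>t. \<Sum>i<\<Delta>. t [i] * pair_sum \<Delta> h (subtree i t) +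
    (\<Sum>j\<in>{..<\<Delta>} - {i}. (t [i] * path_sum \<Delta> h (subtree i t)) * (t [j] * path_sum \<Delta> h (subtree j t))))"
    by (simp add: fun_eq_iff)
  moreover have "multiaffine ?S \<dots>"
    by (intro multiaffine_sum multiaffine.add diag off)
  ultimately show ?case by (simp only:)
qed

section \<open>Values at a constant argument\<close>

lemma path_sum_const: "path_sum \<Delta> h (\<lambda>_. m) = (real \<Delta> * m) ^ h"
  by (induction h) (simp_all add: subtree_def)

text \<open>Divided by \<open>r ^ (2 * h)\<close>, the recursion reads
  \<open>b' \<le> b / r + 1\<close>. Its fixed point is \<open>r / (r - 1)\<close>, which exceeds
  the initial value 1.\<close>

lemma pair_sum_const_le:
  assumes r: "r = real \<Delta> * m" "r > 1" and m: "m \<ge> 0"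
  shows "pair_sum \<Delta> h (\<lambda>_. m) \<le> r ^ (2 * h) * (r / (r - 1))"
proof (induction h)
  case 0
  then show ?case using r by simp
next
  case (Suc h)
  \<comment> \<open>The inner sum is enlarged by the nonnegative term \<open>j = i\<close>.\<close>
  have "pair_sum \<Delta> (Suc h) (\<lambda>_. m) \<le> (\<Sum>i<\<Delta>. m * pair_sum \<Delta> h (\<lambda>_. m) + (\<Sum>j<\<Delta>. (m * r ^ h) * (m * r ^ h)))"
    unfolding pair_sum.simps subtree_def path_sum_const r(1)[symmetric] using r m
    by (intro sum_mono add_left_mono sum_mono2) auto
  also have "\<dots> = r * pair_sum \<Delta> h (\<lambda>_. m) + r\<^sup>2 * r ^ (2 * h)"
    by (simp add: r(1) power2_eq_square algebra_simps power_mult)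
  also have "\<dots> \<le> r * (r ^ (2 * h) * (r / (r - 1))) + r\<^sup>2 * r ^ (2 * h)"
    using Suc r(2) by (intro add_right_mono mult_left_mono) auto
  also have "\<dots> = r ^ (2 * Suc h) * (r / (r - 1))"
    using r(2) by (simp add: power2_eq_square field_simps)
  finally show ?case .
qed

section \<open>Measurability and boundedness of the total variation distance\<close>

lemma leaf_prob_measurable:
  assumes "\<And>v. v \<in> tree_vertices \<Delta> h - {[]} \<Longrightarrow> (\<lambda>x. \<theta> x v) \<in> borel_measurable M"
  shows "(\<lambda>x. leaf_prob \<Delta> h (\<theta> x) s \<tau>) \<in> borel_measurable M"
  using assms
proof (induction h arbitrary: \<theta> s \<tau>)
  case 0
  then show ?case by simp
next
  case (Suc h)
  have sub: "(\<lambda>x. \<theta> x (i # v)) \<in> borel_measurable M" if "i < \<Delta>" "v \<in> tree_vertices \<Delta> h" for i v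
    using that by (intro Suc.prems) (auto simp: tree_vertices_Suc Cons_in_graft)
  have "(\<lambda>x. leaf_prob \<Delta> h (subtree i (\<theta> x)) s' (subtree i \<tau>)) \<in> borel_measurable M"
    if "i < \<Delta>" for i s'
    using sub that by (intro Suc.IH) (auto simp: subtree_def)
  moreover have "(\<lambda>x. \<theta> x [i]) \<in> borel_measurable M" if "i < \<Delta>" for i
    using that by (intro sub Nil_in_tree_vertices)
  ultimately show ?case
    unfolding leaf_prob.simps edge_kernel_def
    by (intro borel_measurable_prod borel_measurable_sum borel_measurable_times
        borel_measurable_divide borel_measurable_add borel_measurable_const) auto
qed

lemma leaf_tv_nonneg: "0 \<le> leaf_tv \<Delta> h \<theta>"
  by (simp add: leaf_tv_def sum_nonneg)

lemma leaf_tv_le_1: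
  assumes "\<And>v. \<bar>\<theta> v\<bar> \<le> 1"
  shows "leaf_tv \<Delta> h \<theta> \<le> 1"
proof -
  let ?\<Omega> = "spin_configs (tree_leaves \<Delta> h)"
  have "\<bar>leaf_prob \<Delta> h \<theta> 1 \<tau> - leaf_prob \<Delta> h \<theta> (-1) \<tau>\<bar> \<le>
      leaf_prob \<Delta> h \<theta> 1 \<tau> + leaf_prob \<Delta> h \<theta> (-1) \<tau>" for \<tau>
    using leaf_prob_nonneg[of \<theta> 1 \<Delta> h \<tau>, OF assms] leaf_prob_nonneg[of \<theta> "-1" \<Delta> h \<tau>, OF assms] by simp
  then have "leaf_tv \<Delta> h \<theta> \<le> (\<Sum>\<tau>\<in>?\<Omega>. leaf_prob \<Delta> h \<theta> 1 \<tau> + leaf_prob \<Delta> h \<theta> (-1) \<tau>) / 2"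
    unfolding leaf_tv_def by (intro divide_right_mono sum_mono) auto
  then show ?thesis
    by (simp add: sum.distrib sum_leaf_prob)
qed

section \<open>Expectations over independent couplings\<close>

locale coupling_distribution = real_distribution \<phi> for \<phi> :: "real measure" +
  fixes \<beta> :: real and \<Delta> :: nat
begin

definition couplings :: "nat \<Rightarrow> (nat list set \<Rightarrow> real) measure" where
  "couplings h = (\<Pi>\<^sub>M e\<in>tree_edges \<Delta> h. \<phi>)"

definition mean_sq_corr :: real where
  "mean_sq_corr = (\<integral>x. (edge_corr \<beta> x)\<^sup>2 \<partial>\<phi>)"

sublocale prod: product_prob_space "\<lambda>_ :: nat list set. \<phi>" UNIV ..

lemma prob_space_couplings: "prob_space (couplings h)"
  unfolding couplings_def by (intro prob_space_PiM prob_space_axioms)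

lemma edge_corr_measurable: "edge_corr \<beta> \<in> borel_measurable \<phi>"
proof -
  have "edge_corr \<beta> \<in> borel_measurable borel"
    unfolding edge_corr_def by measurable
  then show ?thesis by simp
qed

lemma edge_corr_sq_le_1: "(edge_corr \<beta> x)\<^sup>2 \<le> 1"
  using abs_edge_corr[of \<beta> x] by (simp add: abs_square_le_1)

lemma integrable_edge_corr_sq: "integrable \<phi> (\<lambda>x. (edge_corr \<beta> x)\<^sup>2)"
  using edge_corr_measurable edge_corr_sq_le_1
  by (intro integrable_const_bound[where B = 1]) auto

lemma mean_sq_corr_nonneg: "0 \<le> mean_sq_corr"
  unfolding mean_sq_corr_def by simp

text \<open>Distinct vertices carry distinct, hence independent, edges. Extending the product by
  factors 1 to all edges makes the product-measure integral applicable.\<close>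

lemma monomial_expectation:
  assumes "U \<subseteq> tree_vertices \<Delta> h - {[]}"
  shows "integrable (couplings h) (\<lambda>J. \<Prod>v\<in>U. (vertex_corr \<beta> J v)\<^sup>2)"
    and "(\<integral>J. (\<Prod>v\<in>U. (vertex_corr \<beta> J v)\<^sup>2) \<partial>couplings h) = (\<Prod>v\<in>U. mean_sq_corr)"
proof -
  let ?E = "tree_edges \<Delta> h"
  define f where "f e x = (if e \<in> parent_edge ` U then (edge_corr \<beta> x)\<^sup>2 else 1)" for e x
  have U: "finite U" "inj_on parent_edge U" "parent_edge ` U \<subseteq> ?E"
    using assms finite_subset[OF assms finite_Diff[OF finite_tree_vertices]]
      inj_on_subset[OF parent_edge_inj assms] by (auto simp: tree_edges_eq)
  have prod_eq: "(\<Prod>e\<in>?E. if e \<in> parent_edge ` U then F e else 1) = (\<Prod>v\<in>U. F (parent_edge v))"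
    for F :: "nat list set \<Rightarrow> real"
  proof -
    have "(\<Prod>e\<in>?E. if e \<in> parent_edge ` U then F e else 1) = (\<Prod>e\<in>parent_edge ` U. F e)"
      using U finite_tree_edges by (intro prod.mono_neutral_cong_right) auto
    then show ?thesis
      using U by (simp add: prod.reindex)
  qed
  have eq: "(\<lambda>J. \<Prod>v\<in>U. (vertex_corr \<beta> J v)\<^sup>2) = (\<lambda>J. \<Prod>e\<in>?E. f e (J e))"
    unfolding f_def vertex_corr_def using prod_eq[of "\<lambda>e. (edge_corr \<beta> (_ e))\<^sup>2"] by simp
  have int: "integrable \<phi> (f e)" for e
    unfolding f_def using integrable_edge_corr_sq by (cases "e \<in> parent_edge ` U") auto
  show "integrable (couplings h) (\<lambda>J. \<Prod>v\<in>U. (vertex_corr \<beta> J v)\<^sup>2)"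
    unfolding eq couplings_def by (intro prod.product_integrable_prod finite_tree_edges int)
  have "(\<integral>J. (\<Prod>v\<in>U. (vertex_corr \<beta> J v)\<^sup>2) \<partial>couplings h) = (\<Prod>e\<in>?E. \<integral>x. f e x \<partial>\<phi>)"
    unfolding eq couplings_def by (intro prod.product_integral_prod finite_tree_edges int)
  also have "\<dots> = (\<Prod>e\<in>?E. if e \<in> parent_edge ` U then mean_sq_corr else 1)"
    by (intro prod.cong refl) (use prob_space in \<open>simp add: f_def mean_sq_corr_def\<close>)
  also have "\<dots> = (\<Prod>v\<in>U. mean_sq_corr)"
    by (rule prod_eq)
  finally show "(\<integral>J. (\<Prod>v\<in>U. (vertex_corr \<beta> J v)\<^sup>2) \<partial>couplings h) = (\<Prod>v\<in>U. mean_sq_corr)" .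
qed

text \<open>By linearity, the case of monomials suffices.\<close>

lemma multiaffine_expectation:
  assumes "multiaffine (tree_vertices \<Delta> h - {[]}) f"
  shows "integrable (couplings h) (\<lambda>J. f (\<lambda>v. (vertex_corr \<beta> J v)\<^sup>2)) \<and>
    (\<integral>J. f (\<lambda>v. (vertex_corr \<beta> J v)\<^sup>2) \<partial>couplings h) = f (\<lambda>_. mean_sq_corr)"
  using assms
  by (induction rule: multiaffine.induct) (auto simp: monomial_expectation simp del: prod_constant)

lemma integrable_leaf_tv: "integrable (couplings h) (\<lambda>J. leaf_tv \<Delta> h (vertex_corr \<beta> J))"
proof -
  interpret C: prob_space "couplings h"
    by (rule prob_space_couplings)
  have "(\<lambda>J. vertex_corr \<beta> J v) \<in> borel_measurable (couplings h)"
    if "v \<in> tree_vertices \<Delta> h - {[]}" for v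
  proof -
    have "parent_edge v \<in> tree_edges \<Delta> h"
      using that by (simp add: tree_edges_eq)
    then show ?thesis
      unfolding vertex_corr_def couplings_def
      by (rule measurable_compose[OF measurable_component_singleton[where M = "\<lambda>_. \<phi>"]
            edge_corr_measurable])
  qed
  then have "(\<lambda>J. leaf_tv \<Delta> h (vertex_corr \<beta> J)) \<in> borel_measurable (couplings h)"
    unfolding leaf_tv_def
    by (intro borel_measurable_divide borel_measurable_sum borel_measurable_abs
        borel_measurable_diff leaf_prob_measurable borel_measurable_const) auto
  moreover have "norm (leaf_tv \<Delta> h (vertex_corr \<beta> J)) \<le> 1" for J
    using leaf_tv_nonneg leaf_tv_le_1[of "vertex_corr \<beta> J"] by (simp add: vertex_corr_def abs_edge_corr)
  ultimately show ?thesis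
    by (intro C.integrable_const_bound[where B = 1]) auto
qed

lemma expected_tv_eq: "expected_tv \<beta> \<phi> \<Delta> h = (\<integral>J. leaf_tv \<Delta> h (vertex_corr \<beta> J) \<partial>couplings h)"
  by (simp add: expected_tv_def tv_dist_leaf_law couplings_def)

lemma expected_tv_nonneg: "0 \<le> expected_tv \<beta> \<phi> \<Delta> h"
  unfolding expected_tv_eq by (intro Bochner_Integration.integral_nonneg leaf_tv_nonneg)

lemma expected_tv_le:
  assumes "c > 0"
  shows "expected_tv \<beta> \<phi> \<Delta> h \<le> c / 2 + (real \<Delta> * mean_sq_corr) ^ h / (2 * c)"
proof -
  interpret C: prob_space "couplings h"
    by (rule prob_space_couplings)
  note A = multiaffine_expectation[OF multiaffine_path_sum, of h]
  have "expected_tv \<beta> \<phi> \<Delta> h \<le>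
      (\<integral>J. c / 2 + path_sum \<Delta> h (\<lambda>v. (vertex_corr \<beta> J v)\<^sup>2) / (2 * c) \<partial>couplings h)"
    unfolding expected_tv_eq using A assms
    by (intro integral_mono integrable_leaf_tv leaf_tv_le) (auto simp: vertex_corr_def abs_edge_corr)
  also have "\<dots> = c / 2 + (real \<Delta> * mean_sq_corr) ^ h / (2 * c)"
    using A by (simp add: C.prob_space path_sum_const)
  finally show ?thesis .
qed

lemma expected_tv_ge:
  "2 * c * path_sum \<Delta> h (\<lambda>_. mean_sq_corr) - c\<^sup>2 * pair_sum \<Delta> h (\<lambda>_. mean_sq_corr) \<le>
    expected_tv \<beta> \<phi> \<Delta> h"
proof -
  note A = multiaffine_expectation[OF multiaffine_path_sum, of h]
  note B = multiaffine_expectation[OF multiaffine_pair_sum, of h]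
  have "2 * c * path_sum \<Delta> h (\<lambda>_. mean_sq_corr) - c\<^sup>2 * pair_sum \<Delta> h (\<lambda>_. mean_sq_corr) =
      (\<integral>J. 2 * c * path_sum \<Delta> h (\<lambda>v. (vertex_corr \<beta> J v)\<^sup>2) -
        c\<^sup>2 * pair_sum \<Delta> h (\<lambda>v. (vertex_corr \<beta> J v)\<^sup>2) \<partial>couplings h)"
    using A B by simp
  also have "\<dots> \<le> expected_tv \<beta> \<phi> \<Delta> h"
    unfolding expected_tv_eq using A B
    by (intro integral_mono integrable_leaf_tv leaf_tv_ge) (auto simp: vertex_corr_def abs_edge_corr)
  finally show ?thesis .
qed

section \<open>The two regimes and their comparison with the threshold\<close>

lemma reconstruction_above:
  assumes "real \<Delta> * mean_sq_corr > 1"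
  shows "reconstruction \<beta> \<phi> \<Delta>"
proof -
  define r where "r = real \<Delta> * mean_sq_corr"
  have r: "r > 1" using assms by (simp add: r_def)
  have "(r - 1) / r \<le> expected_tv \<beta> \<phi> \<Delta> h" for h
  proof -
    \<comment> \<open>With \<open>a = r ^ h\<close> and
      \<open>b = r ^ (2 * h) * (r / (r - 1))\<close>, this is the maximizer \<open>a / b\<close> of
      \<open>2 * c * a - c\<^sup>2 * b\<close>. The maximum
      \<open>a\<^sup>2 / b = (r - 1) / r\<close> does not depend on \<open>h\<close>.\<close>
    define c where "c = (r - 1) / r / r ^ h"
    have "(r - 1) / r = 2 * c * r ^ h - c\<^sup>2 * (r ^ (2 * h) * (r / (r - 1)))"
    proof -
      have "c * r ^ h = (r - 1) / r" using r by (simp add: c_def)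
      moreover have "c\<^sup>2 * (r ^ (2 * h) * (r / (r - 1))) = (c * r ^ h)\<^sup>2 * (r / (r - 1))"
        by (simp add: power_mult_distrib power_even_eq)
      ultimately show ?thesis
        using r by (simp add: mult.assoc power2_eq_square)
    qed
    also have "\<dots> \<le> 2 * c * path_sum \<Delta> h (\<lambda>_. mean_sq_corr) - c\<^sup>2 * pair_sum \<Delta> h (\<lambda>_. mean_sq_corr)"
      unfolding path_sum_const r_def[symmetric]
      by (intro diff_left_mono mult_left_mono pair_sum_const_le r mean_sq_corr_nonneg)
        (simp_all add: r_def)
    also have "\<dots> \<le> expected_tv \<beta> \<phi> \<Delta> h"
      by (rule expected_tv_ge)
    finally show ?thesis .
  qed
  then have "ereal ((r - 1) / r) \<le> limsup (\<lambda>h. ereal (expected_tv \<beta> \<phi> \<Delta> h))"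
    by (intro le_Limsup) auto
  moreover have "0 < ereal ((r - 1) / r)"
    using r by simp
  ultimately show ?thesis
    unfolding reconstruction_def by (rule less_le_trans[rotated])
qed

lemma non_reconstruction_below:
  assumes "real \<Delta> * mean_sq_corr < 1"
  shows "non_reconstruction \<beta> \<phi> \<Delta>"
proof -
  have "(\<lambda>h. expected_tv \<beta> \<phi> \<Delta> h) \<longlonglongrightarrow> 0"
  proof (rule LIMSEQ_I)
    fix \<epsilon> :: real assume \<epsilon>: "\<epsilon> > 0"
    have "(\<lambda>h. (real \<Delta> * mean_sq_corr) ^ h) \<longlonglongrightarrow> 0"
      using assms mean_sq_corr_nonneg by (intro LIMSEQ_realpow_zero) auto
    \<comment> \<open>The bound is used with \<open>c = \<epsilon>\<close>; once the power is below
      \<open>\<epsilon>\<^sup>2\<close>, its second term is below \<open>\<epsilon> / 2\<close>,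
      like the first term \<open>\<epsilon> / 2\<close> adding up to less than \<epsilon>.\<close>
    then have "\<forall>\<^sub>F h in sequentially. (real \<Delta> * mean_sq_corr) ^ h < \<epsilon>\<^sup>2"
      using \<epsilon> by (intro order_tendstoD) auto
    then obtain N where N: "(real \<Delta> * mean_sq_corr) ^ h < \<epsilon>\<^sup>2" if "h \<ge> N" for h
      unfolding eventually_sequentially by blast
    have "norm (expected_tv \<beta> \<phi> \<Delta> h - 0) < \<epsilon>" if "h \<ge> N" for h
    proof -
      have "(real \<Delta> * mean_sq_corr) ^ h / (2 * \<epsilon>) < \<epsilon>\<^sup>2 / (2 * \<epsilon>)"
        using N[OF that] \<epsilon> by (intro divide_strict_right_mono) auto
      then have "expected_tv \<beta> \<phi> \<Delta> h < \<epsilon> / 2 + \<epsilon> / 2"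
        using expected_tv_le[OF \<epsilon>, of h] \<epsilon> by (simp add: power2_eq_square)
      then show ?thesis
        using expected_tv_nonneg[of h] by simp
    qed
    then show "\<exists>N. \<forall>h\<ge>N. norm (expected_tv \<beta> \<phi> \<Delta> h - 0) < \<epsilon>"
      by blast
  qed
  then have "(\<lambda>h. ereal (expected_tv \<beta> \<phi> \<Delta> h)) \<longlonglongrightarrow> ereal 0"
    by simp
  then have "limsup (\<lambda>h. ereal (expected_tv \<beta> \<phi> \<Delta> h)) = ereal 0"
    by (intro lim_imp_Limsup) auto
  then show ?thesis
    by (simp add: non_reconstruction_def zero_ereal_def)
qed

lemma Delta_KS_eq: "Delta_KS \<beta> \<phi> = inverse (ereal mean_sq_corr)"
proof -
  have "((1 - exp (\<beta> * x)) / (1 + exp (\<beta> * x)))\<^sup>2 = (edge_corr \<beta> x)\<^sup>2" for x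
    unfolding edge_corr_def power_divide by (simp add: power2_commute add.commute)
  then show ?thesis
    by (simp add: Delta_KS_def mean_sq_corr_def)
qed

text \<open>If \<open>mean_sq_corr\<close> is 0, the extended inverse is infinite and both sides are
  false; otherwise the inequality is multiplied by this positive number.\<close>

lemma Delta_KS_less_iff: "Delta_KS \<beta> \<phi> < ereal (real \<Delta>) \<longleftrightarrow> 1 < real \<Delta> * mean_sq_corr"
  using mean_sq_corr_nonneg unfolding Delta_KS_eq
  by (cases "mean_sq_corr = 0") (auto simp: field_simps)

lemma less_Delta_KS_iff: "ereal (real \<Delta>) < Delta_KS \<beta> \<phi> \<longleftrightarrow> real \<Delta> * mean_sq_corr < 1"
  using mean_sq_corr_nonneg unfolding Delta_KS_eq
  by (cases "mean_sq_corr = 0") (auto simp: field_simps)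

end

theorem theorem2p1:
  fixes \<beta> :: real and \<phi> :: "real measure"
  assumes "\<beta> > 0" and "real_distribution \<phi>"
  shows "(\<forall>\<Delta>::nat. \<Delta> > 0 \<and> ereal (real \<Delta>) > Delta_KS \<beta> \<phi> \<longrightarrow> reconstruction \<beta> \<phi> \<Delta>) \<and>
         (\<forall>\<Delta>::nat. \<Delta> > 0 \<and> ereal (real \<Delta>) < Delta_KS \<beta> \<phi> \<longrightarrow> non_reconstruction \<beta> \<phi> \<Delta>)"
proof -
  have cd: "coupling_distribution \<phi>"
    using assms(2) by (rule coupling_distribution.intro)
  show ?thesis
    using coupling_distribution.reconstruction_above[OF cd]
      coupling_distribution.non_reconstruction_below[OF cd]
      coupling_distribution.Delta_KS_less_iff[OF cd]
      coupling_distribution.less_Delta_KS_iff[OF cd]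
    by blast
qed

end
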